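(* Let $G$ be a multigraph with maximum edge multiplicity $\mu$ and maximum degree $\Delta$, and let $M$ be a set of edges of $G$ such that the distance between any two distinct edges of $M$ is at least $9$. Suppose each edge of $M$ is assigned a colour from the palette $\mathcal{K}=\{1,\dots,\Delta+\mu\}$, arbitrarily. Then there is a proper edge-colouring of $G$ using only colours from $\mathcal{K}$ that agrees with this precolouring on $M$.
   Context: The distance between two edges is the number of edges in a shortest path between an endpoint of one and an endpoint of the other. A proper edge-colouring assigns colours to edges so that any two edges sharing an endpoint receive different colours (parallel edges share endpoints). Multigraphs may have parallel edges; the maximum edge multiplicity is the largest number of edges joining a single pair of vertices. *)

theory Defs
  imports Main "HOL-Library.Extended_Nat"
begin

record ('v, 'e) mgraph =
  verts :: "'v set"
  edges :: "'e set"
  ends :: "'e \<Rightarrow> 'v set"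

text \<open>Finite undirected loopless multigraphs: edges are objects in their own right, so distinct
  edges may have the same set of endpoints.\<close>

locale multigraph =
  fixes G :: "('v, 'e) mgraph"
  assumes finite_verts: "finite (verts G)"
    and finite_edges: "finite (edges G)"
    and ends_in_verts: "e \<in> edges G \<Longrightarrow> ends G e \<subseteq> verts G"
    and card_ends: "e \<in> edges G \<Longrightarrow> card (ends G e) = 2"

definition degree :: "('v, 'e) mgraph \<Rightarrow> 'v \<Rightarrow> nat" where
  "degree G v = card {e \<in> edges G. v \<in> ends G e}"

definition multiplicity :: "('v, 'e) mgraph \<Rightarrow> 'v \<Rightarrow> 'v \<Rightarrow> nat" where
  "multiplicity G u v = card {e \<in> edges G. ends G e = {u, v}}"

text \<open>The inserted \<open>0\<close> only matters for graphs without vertices.\<close>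

definition max_degree :: "('v, 'e) mgraph \<Rightarrow> nat" where
  "max_degree G = Max (insert 0 (degree G ` verts G))"

definition max_multiplicity :: "('v, 'e) mgraph \<Rightarrow> nat" where
  "max_multiplicity G = Max (insert 0 ((\<lambda>(u, v). multiplicity G u v) ` (verts G \<times> verts G)))"

definition adjacent :: "('v, 'e) mgraph \<Rightarrow> 'v \<Rightarrow> 'v \<Rightarrow> bool" where
  "adjacent G u v \<longleftrightarrow> (\<exists>e \<in> edges G. ends G e = {u, v})"

text \<open>A path is given by its sequence of vertices; it has \<open>length p - 1\<close> edges.\<close>

definition path :: "('v, 'e) mgraph \<Rightarrow> 'v list \<Rightarrow> bool" where
  "path G p \<longleftrightarrow> p \<noteq> [] \<and> set p \<subseteq> verts G \<and> distinct p \<and> successively (adjacent G) p"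

text \<open>The infimum over the empty set is \<open>\<infinity>\<close>: edges in different components are at infinite
  distance.\<close>

definition edge_distance :: "('v, 'e) mgraph \<Rightarrow> 'e \<Rightarrow> 'e \<Rightarrow> enat" where
  "edge_distance G e f =
     (INF p \<in> {p. path G p \<and> hd p \<in> ends G e \<and> last p \<in> ends G f}. enat (length p - 1))"

definition proper_edge_colouring :: "('v, 'e) mgraph \<Rightarrow> ('e \<Rightarrow> 'c) \<Rightarrow> bool" where
  "proper_edge_colouring G c \<longleftrightarrow>
     (\<forall>e \<in> edges G. \<forall>f \<in> edges G. e \<noteq> f \<longrightarrow> ends G e \<inter> ends G f \<noteq> {} \<longrightarrow> c e \<noteq> c f)"

end

theory Submission
  imports Defs "HOL-Library.Transitive_Closure_Table"
begin

text \<open>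
  Colour \<open>1\<close> is set aside. Among all proper colourings with palette \<open>{1..\<Delta> + \<mu>}\<close> that give every
  edge of \<open>M\<close> colour \<open>1\<close>, take one with as few edges of colour \<open>1\<close> as possible. If such an edge
  \<open>xr\<close> outside \<open>M\<close> is uncoloured, it cannot be recoloured with the other colours, so the fan at \<open>r\<close>
  starting at \<open>x\<close> is elementary, and counting missing colours shows that it contains a vertex other
  than \<open>x\<close> that sees no edge of colour \<open>1\<close>: the \<open>1\<close>-edge can be moved there by a purely local shift.

  To give \<open>e = uv\<close> in \<open>M\<close> its colour \<open>k\<close>, let \<open>uw\<close> and \<open>vz\<close> be the edges of colour \<open>k\<close> at \<open>u\<close> and
  \<open>v\<close>. If \<open>w\<close> and \<open>z\<close> see no colour \<open>1\<close>, exchange \<open>k\<close> and \<open>1\<close> on \<open>uw\<close>, \<open>uv\<close>, \<open>vz\<close>. A shift frees \<open>w\<close>. To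
  free \<open>z\<close> without covering \<open>w\<close> again, follow the \<open>(1, \<alpha>)\<close>-chain from \<open>z\<close>, where \<open>\<alpha>\<close> is missing
  at \<open>z\<close>: exchanging an initial piece of it frees \<open>z\<close> and leaves a hole, whose fan has two
  vertices free of colour \<open>1\<close>. Either the hole can be filled away from \<open>w\<close> and \<open>z\<close>, or the centre
  of the fan is adjacent to \<open>w\<close>, so that the chain stays close to \<open>e\<close>. Shifting the \<open>1\<close>-edge at
  \<open>z\<close> to another neighbour yields a second such chain, and at least one combination of the two solves
  the problem even when the chains run into \<open>w\<close> or \<open>e\<close>. All changes for \<open>e\<close> happen within distance \<open>5\<close>, and the final
  exchange within distance \<open>3\<close>, so the edges of \<open>M\<close> do not interfere.
\<close>

lemma rtrancl_path_Nil_iff: "rtrancl_path r x [] y \<longleftrightarrow> x = y"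
  by (subst rtrancl_path.simps) auto

lemma rtrancl_path_Cons_iff: "rtrancl_path r x (z # zs) y \<longleftrightarrow> r x z \<and> rtrancl_path r z zs y"
  by (subst rtrancl_path.simps) auto

subsection \<open>Partial colourings and Kempe exchanges\<close>

locale palette = multigraph G for G :: "('v, 'e) mgraph" +
  fixes \<Delta> \<mu> :: nat
  assumes degree_le: "y \<in> verts G \<Longrightarrow> degree G y \<le> \<Delta>"
    and multiplicity_le: "x \<in> verts G \<Longrightarrow> y \<in> verts G \<Longrightarrow> multiplicity G x y \<le> \<mu>"
begin

text \<open>Colour \<open>0\<close> means uncoloured.\<close>

definition partial_colouring :: "('e \<Rightarrow> nat) \<Rightarrow> bool" where
  "partial_colouring c \<longleftrightarrow> (\<forall>g \<in> edges G. c g \<le> \<Delta> + \<mu>) \<and>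
     (\<forall>g \<in> edges G. \<forall>h \<in> edges G. g \<noteq> h \<longrightarrow> ends G g \<inter> ends G h \<noteq> {} \<longrightarrow> c g = c h \<longrightarrow> c g = 0)"

definition free :: "('e \<Rightarrow> nat) \<Rightarrow> 'v \<Rightarrow> nat \<Rightarrow> bool" where
  "free c y a \<longleftrightarrow> (\<forall>g \<in> edges G. y \<in> ends G g \<longrightarrow> c g \<noteq> a)"

text \<open>Colour \<open>1\<close> is left out so that fans never recolour \<open>M\<close>.\<close>

definition miss :: "('e \<Rightarrow> nat) \<Rightarrow> 'v \<Rightarrow> nat set" where
  "miss c y = {a. 2 \<le> a \<and> a \<le> \<Delta> + \<mu> \<and> free c y a}"

definition ones :: "('e \<Rightarrow> nat) \<Rightarrow> 'e set" where
  "ones c = {g \<in> edges G. c g = 1}"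

definition zeros :: "('e \<Rightarrow> nat) \<Rightarrow> 'e set" where
  "zeros c = {g \<in> edges G. c g = 0}"

text \<open>Competitors must have the same class of colour \<open>1\<close>; fan shifts and
  exchanges of colours from \<open>2\<close> on preserve this class.\<close>

definition irreducible :: "('e \<Rightarrow> nat) \<Rightarrow> bool" where
  "irreducible c \<longleftrightarrow>
     (\<forall>c'. partial_colouring c' \<longrightarrow> ones c' = ones c \<longrightarrow> card (zeros c) \<le> card (zeros c'))"

text \<open>Unions of components of the edges coloured \<open>a\<close> or \<open>b\<close>; such
  sets take the place of alternating paths.\<close>

definition kempe_closed :: "('e \<Rightarrow> nat) \<Rightarrow> nat \<Rightarrow> nat \<Rightarrow> 'v set \<Rightarrow> bool" where
  "kempe_closed c a b S \<longleftrightarrow>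
     (\<forall>g \<in> edges G. c g \<in> {a, b} \<longrightarrow> ends G g \<inter> S \<noteq> {} \<longrightarrow> ends G g \<subseteq> S)"

definition kempe_swap :: "'v set \<Rightarrow> nat \<Rightarrow> nat \<Rightarrow> ('e \<Rightarrow> nat) \<Rightarrow> 'e \<Rightarrow> nat" where
  "kempe_swap S a b c g = (if ends G g \<inter> S = {} then c g
     else if c g = a then b else if c g = b then a else c g)"

lemma ends_cases:
  assumes "g \<in> edges G" "x \<in> ends G g"
  obtains y where "ends G g = {x, y}" "x \<noteq> y" "y \<in> verts G"
proof -
  obtain p q where pq: "ends G g = {p, q}" "p \<noteq> q"
    using card_ends[OF assms(1)] by (auto simp: card_2_iff)
  have "{p, q} \<subseteq> verts G" using ends_in_verts[OF assms(1)] pq by auto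
  then show thesis using that assms(2) pq by (cases "x = p") (auto simp: insert_commute)
qed

lemma ends_neq: "g \<in> edges G \<Longrightarrow> ends G g = {x, y} \<Longrightarrow> x \<noteq> y"
  using card_ends[of g] by auto

lemma ends_verts: "g \<in> edges G \<Longrightarrow> y \<in> ends G g \<Longrightarrow> y \<in> verts G"
  using ends_in_verts by blast

lemma multiplicity_pos:
  assumes "f \<in> edges G"
  shows "1 \<le> \<mu>"
proof -
  obtain x r where xr: "ends G f = {x, r}" using card_ends[OF assms] by (auto simp: card_2_iff)
  then have "{g \<in> edges G. ends G g = {x, r}} \<noteq> {}" using assms by auto
  then have "multiplicity G x r > 0"
    unfolding multiplicity_def using finite_edges by (simp add: card_gt_0_iff)
  then show ?thesis using multiplicity_le[of x r] assms xr ends_verts by fastforce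
qed

lemma partial_colouring_unique:
  assumes "partial_colouring c" "g \<in> edges G" "h \<in> edges G" "y \<in> ends G g" "y \<in> ends G h" "c g = c h" "c g \<noteq> 0"
  shows "g = h"
  using assms unfolding partial_colouring_def by (metis IntI empty_iff)

lemma partial_colouring_le: "partial_colouring c \<Longrightarrow> g \<in> edges G \<Longrightarrow> c g \<le> \<Delta> + \<mu>"
  unfolding partial_colouring_def by blast

lemma partial_colouring_uncolour: "partial_colouring c \<Longrightarrow> partial_colouring (c(g := 0))"
  unfolding partial_colouring_def by auto

lemma partial_colouring_colour:
  assumes "partial_colouring c" "ends G f = {x, y}" "free c x a" "free c y a" "a \<le> \<Delta> + \<mu>"
  shows "partial_colouring (c(f := a))"
  using assms unfolding partial_colouring_def free_def by auto

lemma not_free_obtain: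
  assumes "\<not> free c y a"
  obtains g where "g \<in> edges G" "y \<in> ends G g" "c g = a"
  using assms unfolding free_def by blast

lemma free_uncolour:
  assumes "partial_colouring c" "g \<in> edges G" "y \<in> ends G g" "c g \<noteq> 0"
  shows "free (c(g := 0)) y (c g)"
  using assms partial_colouring_unique[OF assms(1)] unfolding free_def by auto

lemma free_upd:
  assumes "free c y b" "y \<notin> ends G f \<or> a \<noteq> b"
  shows "free (c(f := a)) y b"
  using assms unfolding free_def by auto

lemma free_recoloured:
  assumes "partial_colouring c" "h \<in> edges G" "y \<in> ends G h" "c h = b" "b \<noteq> 0" "c' h \<noteq> b"
    and "\<And>g. g \<in> edges G \<Longrightarrow> y \<in> ends G g \<Longrightarrow> g \<noteq> h \<Longrightarrow> c' g = b \<Longrightarrow> c g = b"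
  shows "free c' y b"
  unfolding free_def
proof (intro ballI impI notI)
  fix g assume g: "g \<in> edges G" "y \<in> ends G g" "c' g = b"
  then have "g \<noteq> h" using assms(6) by auto
  moreover have "c g = b" using assms(7) g \<open>g \<noteq> h\<close> by blast
  ultimately show False using partial_colouring_unique[OF assms(1) g(1) assms(2) g(2) assms(3)] assms(4,5) by simp
qed

lemma free_weaken:
  assumes "free c y b" "\<And>g. g \<in> edges G \<Longrightarrow> y \<in> ends G g \<Longrightarrow> c' g = b \<Longrightarrow> c g = b"
  shows "free c' y b"
  using assms unfolding free_def by blast

lemma free_one_iff: "ones c = ones c' \<Longrightarrow> free c y 1 \<longleftrightarrow> free c' y 1"
  unfolding free_def ones_def by blast

lemma partial_colouring_kempe_swap:
  assumes "partial_colouring c" "kempe_closed c a b S" "a \<noteq> 0" "b \<noteq> 0" "a \<le> \<Delta> + \<mu>" "b \<le> \<Delta> + \<mu>"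
  shows "partial_colouring (kempe_swap S a b c)"
  unfolding partial_colouring_def
proof (intro conjI ballI impI)
  fix g assume "g \<in> edges G"
  then show "kempe_swap S a b c g \<le> \<Delta> + \<mu>" using assms partial_colouring_le by (auto simp: kempe_swap_def)
next
  fix g h assume gh: "g \<in> edges G" "h \<in> edges G" "g \<noteq> h" "ends G g \<inter> ends G h \<noteq> {}"
    and eq: "kempe_swap S a b c g = kempe_swap S a b c h"
  then obtain y where y: "y \<in> ends G g" "y \<in> ends G h" by blast
  have cl: "c f \<in> {a, b} \<Longrightarrow> kempe_swap S a b c f = (if y \<in> S then (if c f = a then b else a) else c f)"
    if "f \<in> {g, h}" for f
    using assms(2) that gh y unfolding kempe_closed_def kempe_swap_def by auto
  have ncl: "c f \<notin> {a, b} \<Longrightarrow> kempe_swap S a b c f = c f" for f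
    unfolding kempe_swap_def by auto
  have "c g = c h"
    using eq cl[of g] cl[of h] ncl[of g] ncl[of h]
    by (cases "c g \<in> {a, b}"; cases "c h \<in> {a, b}"; cases "y \<in> S") (auto split: if_splits)
  then have "c g = 0" using partial_colouring_unique[OF assms(1) gh(1,2) y] gh(3) by blast
  then show "kempe_swap S a b c g = 0" using assms(3,4) by (auto simp: kempe_swap_def)
qed

lemma free_kempe_swap:
  assumes "kempe_closed c a b S" "a \<noteq> b"
  shows "y \<in> S \<Longrightarrow> free (kempe_swap S a b c) y a \<longleftrightarrow> free c y b"
    and "y \<in> S \<Longrightarrow> free (kempe_swap S a b c) y b \<longleftrightarrow> free c y a"
    and "y \<notin> S \<Longrightarrow> free (kempe_swap S a b c) y d \<longleftrightarrow> free c y d"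
    and "d \<notin> {a, b} \<Longrightarrow> free (kempe_swap S a b c) y d \<longleftrightarrow> free c y d"
  using assms unfolding free_def kempe_swap_def kempe_closed_def
  by (auto split: if_splits)

lemma zeros_kempe_swap: "a \<noteq> 0 \<Longrightarrow> b \<noteq> 0 \<Longrightarrow> zeros (kempe_swap S a b c) = zeros c"
  unfolding zeros_def kempe_swap_def by auto

lemma finite_zeros: "finite (zeros c)" and finite_ones: "finite (ones c)"
  using finite_edges by (auto simp: zeros_def ones_def)

text \<open>At most \<open>\<Delta>\<close> edges meet \<open>y\<close>, and those of colour
  \<open>0\<close> or \<open>1\<close> use none of the \<open>\<Delta> + \<mu> - 1\<close> colours
  counted by \<open>miss\<close>. This surplus drives \<open>fan_two_free\<close>.\<close>

lemma card_miss_ge: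
  assumes "partial_colouring c" "y \<in> verts G" 
  shows "\<mu> + (if free c y 1 then 0 else 1) + card {g \<in> zeros c. y \<in> ends G g} \<le> card (miss c y) + 1"
proof -
  let ?I = "{g \<in> edges G. y \<in> ends G g}"
  let ?A = "{g \<in> ?I. 2 \<le> c g}" and ?B = "{g \<in> ?I. c g = 1}" and ?C = "{g \<in> zeros c. y \<in> ends G g}"
  have I: "?I = ?A \<union> (?B \<union> ?C)" unfolding zeros_def by auto
  have "card ?I = card ?A + card (?B \<union> ?C)"
    by (subst I, subst card_Un_disjoint) (use finite_edges in \<open>auto simp: zeros_def\<close>)
  also have "card (?B \<union> ?C) = card ?B + card ?C"
    by (subst card_Un_disjoint) (use finite_edges in \<open>auto simp: zeros_def\<close>)
  finally have cI: "card ?I = card ?A + (card ?B + card ?C)" .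
  have B: "(if free c y 1 then 0 else 1) \<le> card ?B"
  proof (cases "free c y 1")
    case False
    then have "?B \<noteq> {}" unfolding free_def by auto
    moreover have "finite ?B" using finite_edges by simp
    ultimately show ?thesis using card_gt_0_iff[of ?B] by auto
  qed simp
  have "{2..\<Delta> + \<mu>} \<subseteq> miss c y \<union> c ` ?A"
    unfolding miss_def free_def by auto
  moreover have "finite (miss c y \<union> c ` ?A)"
    using finite_edges unfolding miss_def by auto
  ultimately have "card {2..\<Delta> + \<mu>} \<le> card (miss c y \<union> c ` ?A)" by (rule card_mono[rotated])
  also have "\<dots> \<le> card (miss c y) + card (c ` ?A)" by (rule card_Un_le)
  also have "card (c ` ?A) \<le> card ?A" using finite_edges by (intro card_image_le) simp
  finally have "\<Delta> + \<mu> \<le> card (miss c y) + card ?A + 1" by simp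
  moreover have "card ?I \<le> \<Delta>" using degree_le[OF assms(2)] unfolding degree_def .
  ultimately show ?thesis using cI B by linarith
qed


text \<open>A set that contains \<open>r\<close> and spans at least \<open>card T - 1\<close> edges of colours \<open>a\<close>, \<open>b\<close> cannot contain
  three vertices of degree at most one in these colours; a largest such set is closed.\<close>

lemma exists_kempe_closed_avoiding:
  assumes "partial_colouring c" "a \<noteq> b" "a \<noteq> 0" "b \<noteq> 0"
    and "free c r b" "free c y1 a" "free c y2 a" "distinct [r, y1, y2]"
    and "{r, y1, y2} \<subseteq> verts G"
  obtains T where "kempe_closed c a b T" "r \<in> T" "y1 \<notin> T \<or> y2 \<notin> T"
proof -
  define F where "F T = {g \<in> edges G. c g \<in> {a, b} \<and> ends G g \<subseteq> T}" for T
  have finF: "finite (F T)" for T unfolding F_def using finite_edges by simp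
  define P where "P T \<longleftrightarrow> r \<in> T \<and> T \<subseteq> verts G \<and> card T \<le> card (F T) + 1" for T
  have "P {r}" using assms(9) unfolding P_def by auto
  moreover have "\<forall>T. P T \<longrightarrow> card T < Suc (card (verts G))"
    unfolding P_def using card_mono[OF finite_verts] by (auto simp: less_Suc_eq_le)
  ultimately have "\<exists>T. P T \<and> (\<forall>T'. P T' \<longrightarrow> card T' \<le> card T)"
    by (rule ex_has_greatest_nat)
  then obtain T where T: "P T" and Tmax: "\<And>T'. P T' \<Longrightarrow> card T' \<le> card T" by metis
  have finT: "finite T" using T finite_verts finite_subset unfolding P_def by blast
  have cl: "kempe_closed c a b T"
    unfolding kempe_closed_def
  proof (intro ballI impI, rule ccontr)
    fix g assume g: "g \<in> edges G" "c g \<in> {a, b}" "ends G g \<inter> T \<noteq> {}" "\<not> ends G g \<subseteq> T"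
    then obtain x where "x \<in> ends G g" "x \<in> T" by blast
    then obtain y where y: "ends G g = {x, y}" "y \<in> verts G" "x \<in> T"
      using ends_cases[OF g(1)] by metis
    with g have "y \<notin> T" by auto
    \<comment> \<open>Adding the outer end of an edge that leaves \<open>T\<close> gains one vertex
      and at least one edge, so the inequality in \<open>P\<close> survives.\<close>
    have "insert g (F T) \<subseteq> F (insert y T)" "g \<notin> F T"
      using g y unfolding F_def by auto
    then have "card (F T) + 1 \<le> card (F (insert y T))"
      using card_mono[OF finF, of "insert g (F T)"] finF[of T] by simp
    then have "P (insert y T)"
      using T y \<open>y \<notin> T\<close> finT unfolding P_def by auto
    then show False using Tmax[of "insert y T"] finT \<open>y \<notin> T\<close> by simp
  qed
  have "y1 \<notin> T \<or> y2 \<notin> T"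
  proof (rule ccontr)
    assume "\<not> ?thesis"
    then have sub: "{r, y1, y2} \<subseteq> T" using T unfolding P_def by auto
    let ?d = "\<lambda>y. card {g \<in> F T. y \<in> ends G g}"
    have one: "card {g \<in> F T. y \<in> ends G g \<and> c g = d} \<le> (if free c y d then 0 else 1)"
      if "d \<in> {a, b}" for y d
    proof (cases "free c y d")
      case True
      then have E: "{g \<in> F T. y \<in> ends G g \<and> c g = d} = {}" unfolding F_def free_def by auto
      show ?thesis unfolding E by simp
    next
      case False
      have "\<forall>g \<in> {g \<in> F T. y \<in> ends G g \<and> c g = d}. \<forall>h \<in> {g \<in> F T. y \<in> ends G g \<and> c g = d}. g = h"
      proof (intro ballI)
        fix g h assume "g \<in> {g \<in> F T. y \<in> ends G g \<and> c g = d}" "h \<in> {g \<in> F T. y \<in> ends G g \<and> c g = d}"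
        then show "g = h"
          by (intro partial_colouring_unique[OF assms(1), of g h y]) (use that assms(3,4) in \<open>auto simp: F_def\<close>)
      qed
      then have "card {g \<in> F T. y \<in> ends G g \<and> c g = d} \<le> Suc 0"
        using finF[of T] by (subst card_le_Suc0_iff_eq) simp_all
      then show ?thesis using False by simp
    qed
    have deg: "?d y \<le> (if free c y a then 0 else 1) + (if free c y b then 0 else 1)" for y
    proof -
      have "?d y = card ({g \<in> F T. y \<in> ends G g \<and> c g = a} \<union> {g \<in> F T. y \<in> ends G g \<and> c g = b})"
        by (rule arg_cong[where f = card]) (auto simp: F_def)
      also have "\<dots> \<le> card {g \<in> F T. y \<in> ends G g \<and> c g = a}
          + card {g \<in> F T. y \<in> ends G g \<and> c g = b}"
        by (rule card_Un_le)
      finally show ?thesis using one[of a y] one[of b y] by simp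
    qed
    \<comment> \<open>Double counting: the degrees in the two colours within \<open>T\<close> add up
      to twice the number of spanned edges.\<close>
    have "(\<Sum>y\<in>T. ?d y) = (\<Sum>g\<in>F T. card {y \<in> T. y \<in> ends G g})"
      using sum.swap_restrict[OF finT finF[of T], of "\<lambda>_ _. 1::nat" "\<lambda>y g. y \<in> ends G g"] by simp
    also have "\<dots> = (\<Sum>g\<in>F T. 2)"
    proof (rule sum.cong[OF refl])
      fix g assume "g \<in> F T"
      then have "{y \<in> T. y \<in> ends G g} = ends G g" "g \<in> edges G" unfolding F_def by auto
      then show "card {y \<in> T. y \<in> ends G g} = 2" using card_ends by simp
    qed
    finally have s1: "(\<Sum>y\<in>T. ?d y) = 2 * card (F T)" by simp
    have split: "sum f T = f r + f y1 + f y2 + sum f (T - {r, y1, y2})" for f :: "'v \<Rightarrow> nat"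
    proof -
      have "sum f T = sum f (T - {r, y1, y2}) + sum f {r, y1, y2}"
        by (rule sum.subset_diff[OF sub finT])
      then show ?thesis using assms(8) by (simp add: add.assoc)
    qed
    have "sum ?d (T - {r, y1, y2}) \<le> (\<Sum>y\<in>T - {r, y1, y2}. 2)"
      using deg by (intro sum_mono) (smt (verit) one_add_one le_trans add_mono zero_le_one order_refl)
    moreover have "?d r \<le> 1" "?d y1 \<le> 1" "?d y2 \<le> 1"
      using deg[of r] deg[of y1] deg[of y2] assms(5-7) by (auto split: if_splits)
    moreover have "(\<Sum>y\<in>T. (2::nat)) = 2 + 2 + 2 + (\<Sum>y\<in>T - {r, y1, y2}. 2)"
      by (rule split)
    \<comment> \<open>Degrees are at most two, and at most one at the three special vertices; but
      \<open>P\<close> forces a sum of at least \<open>2 * card T - 2\<close>.\<close>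
    ultimately have "(\<Sum>y\<in>T. ?d y) + 3 \<le> 2 * card T"
      using split[of ?d] by simp
    then show False using s1 T unfolding P_def by linarith
  qed
  then show thesis using that cl T unfolding P_def by blast
qed

subsection \<open>Fans\<close>

text \<open>The vertices reachable from \<open>x\<close> by these steps are those of a maximal
  Vizing fan with centre \<open>r\<close>.\<close>

definition fan_step :: "('e \<Rightarrow> nat) \<Rightarrow> 'v \<Rightarrow> 'v \<Rightarrow> 'v \<Rightarrow> bool" where
  "fan_step c r p p' \<longleftrightarrow> (\<exists>g \<in> edges G. ends G g = {r, p'} \<and> c g \<in> miss c p)"

lemma fan_step_neq: "fan_step c r p p' \<Longrightarrow> p' \<noteq> r"
  unfolding fan_step_def using ends_neq by blast

text \<open>The Vizing shift, by induction on the path: the hole takes the colour of the next edge,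
  which becomes the new hole. Only edges at \<open>r\<close> change. \<open>H\<close> is a set of
  edges to be kept intact: the shift stops as soon as the hole lies in \<open>H\<close>, and
  otherwise reaches \<open>y\<close> without touching \<open>H\<close>.\<close>

lemma hole_move_path:
  assumes "rtrancl_path (fan_step c r) x ys y" "distinct (x # ys)"
    and "partial_colouring c" "f \<in> edges G" "c f = 0" "ends G f = {x, r}"
  shows "\<exists>g p c'. g \<in> edges G \<and> partial_colouring c' \<and> c' g = 0 \<and> ends G g = {r, p} \<and> p \<in> set (x # ys) \<and>
    (\<forall>h. r \<notin> ends G h \<longrightarrow> c' h = c h) \<and> zeros c' = insert g (zeros c - {f}) \<and> ones c' = ones c \<and>
    (\<forall>a. free c r a \<longrightarrow> a \<noteq> 0 \<longrightarrow> free c' r a) \<and>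
    (\<forall>a. a \<noteq> 0 \<longrightarrow> free (c(g := 0)) p a \<longrightarrow> free c' p a) \<and>
    (g \<in> H \<or> p = y \<and> (\<forall>h \<in> H. c' h = c h))"
  using assms
proof (induction ys arbitrary: x c f)
  case Nil
  from Nil.prems(1) have "x = y" by (simp add: rtrancl_path_Nil_iff)
  have "insert f (zeros c - {f}) = zeros c" "ends G f = {r, x}" "c(f := 0) = c"
    using Nil.prems(4-6) by (auto simp: zeros_def)
  then show ?case using \<open>x = y\<close> Nil.prems(3-5)
    by (intro exI[of _ f] exI[of _ x] exI[of _ c]) simp
next
  case (Cons y1 ys)
  show ?case
  proof (cases "f \<in> H")
    case True
    moreover have "insert f (zeros c - {f}) = zeros c" "ends G f = {r, x}" "c(f := 0) = c"
      using Cons.prems(4-6) by (auto simp: zeros_def)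
    ultimately show ?thesis using Cons.prems(3-5)
      by (intro exI[of _ f] exI[of _ x] exI[of _ c]) simp
  next
    case fH: False
    from Cons.prems(1) have st: "fan_step c r x y1" and rp: "rtrancl_path (fan_step c r) y1 ys y"
      by (simp_all add: rtrancl_path_Cons_iff)
    from st obtain g where g: "g \<in> edges G" "ends G g = {r, y1}" "c g \<in> miss c x"
      unfolding fan_step_def by blast
    define a where "a = c g"
    have a: "2 \<le> a" "a \<le> \<Delta> + \<mu>" "free c x a" using g(3) unfolding miss_def a_def by auto
    have neq: "y1 \<noteq> r" "x \<noteq> r" "x \<noteq> y1"
      using g(1,2) ends_neq Cons.prems(2,4,6) by auto
    have gf: "g \<noteq> f" using Cons.prems(5) a unfolding a_def by auto
    define c1 where "c1 = c(g := 0, f := a)"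
    have col1: "partial_colouring c1"
      unfolding c1_def
    proof (rule partial_colouring_colour)
      show "partial_colouring (c(g := 0))" using partial_colouring_uncolour Cons.prems(3) by blast
      show "ends G f = {x, r}" by fact
      show "free (c(g := 0)) x a" using a by (intro free_upd) auto
      show "free (c(g := 0)) r a"
        unfolding a_def using free_uncolour[OF Cons.prems(3) g(1), of r] g(2) a by (auto simp: a_def)
    qed (use a in auto)
    have miss_sub: "miss c p \<subseteq> miss c1 p" if "p \<noteq> x" "p \<noteq> r" for p
      unfolding miss_def c1_def using that Cons.prems(6) by (auto simp: free_def)
    \<comment> \<open>The rest of the path stays a fan path: its edges are neither \<open>f\<close>
      nor \<open>g\<close>, and its vertices, being different from \<open>x\<close> and
      \<open>r\<close>, lose no missing colour.\<close>
    have rp1: "rtrancl_path (fan_step c1 r) y1 ys y"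
    proof -
      have "distinct (y1 # ys) \<Longrightarrow> x \<notin> set (p # qs) \<Longrightarrow> y1 \<notin> set qs \<Longrightarrow> p \<noteq> r \<Longrightarrow>
          rtrancl_path (fan_step c r) p qs y \<Longrightarrow> rtrancl_path (fan_step c1 r) p qs y" for p qs
      proof (induction qs arbitrary: p)
        case Nil
        from Nil.prems(5) have "p = y" by (simp add: rtrancl_path_Nil_iff)
        then show ?case by (simp add: rtrancl_path.base)
      next
        case (Cons p' qs)
        from Cons.prems(5) have s: "fan_step c r p p'" and s': "rtrancl_path (fan_step c r) p' qs y"
          by (simp_all add: rtrancl_path_Cons_iff)
        then obtain h where h: "h \<in> edges G" "ends G h = {r, p'}" "c h \<in> miss c p"
          unfolding fan_step_def by blast
        have p'r: "p' \<noteq> r" using fan_step_neq[OF s] .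
        have "h \<noteq> f" "h \<noteq> g"
          using h(2) g(2) \<open>ends G f = {x, r}\<close> Cons.prems(2,3) neq p'r by (auto simp: doubleton_eq_iff)
        then have "c1 h = c h" unfolding c1_def by simp
        then have "fan_step c1 r p p'"
          using h miss_sub[of p] Cons.prems(2,4) unfolding fan_step_def by (intro bexI[of _ h]) auto
        then show ?case using Cons s' p'r by (auto intro: rtrancl_path.step)
      qed
      then show ?thesis using rp Cons.prems(2) neq by auto
    qed
    have e1: "ends G g = {y1, r}" using g by auto
    have z1: "zeros c1 = insert g (zeros c - {f})"
      unfolding zeros_def c1_def using gf a g by auto
    have c1g: "c1 g = 0" unfolding c1_def using gf by simp
    have d1: "distinct (y1 # ys)" using Cons.prems(2) by simp
    from Cons.IH[OF rp1 d1 col1 g(1) c1g e1]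
    obtain g' p c' where IH: "g' \<in> edges G" "partial_colouring c'" "c' g' = 0" "ends G g' = {r, p}" "p \<in> set (y1 # ys)"
      "\<forall>h. r \<notin> ends G h \<longrightarrow> c' h = c1 h" "zeros c' = insert g' (zeros c1 - {g})" "ones c' = ones c1"
      "\<forall>a. free c1 r a \<longrightarrow> a \<noteq> 0 \<longrightarrow> free c' r a"
      "\<forall>a. a \<noteq> 0 \<longrightarrow> free (c1(g' := 0)) p a \<longrightarrow> free c' p a"
      "g' \<in> H \<or> p = y \<and> (\<forall>h \<in> H. c' h = c1 h)"
      by blast
    have fr: "free c1 r b" if "free c r b" "b \<noteq> 0" for b
      using that g unfolding c1_def a_def by (auto simp: free_def)
    have o: "ones c1 = ones c" unfolding ones_def c1_def using a Cons.prems(5) a_def by auto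
    have rr1: "c1 h = c h" if "r \<notin> ends G h" for h
      using that g(2) Cons.prems(6) unfolding c1_def by auto
    have fp: "free (c1(h := 0)) p b" if "p \<noteq> r" "p \<noteq> x" "free (c(h := 0)) p b" "b \<noteq> 0" for h p b
      using that Cons.prems(6) unfolding c1_def by (auto simp: free_def)
    have c1g0: "c1(g := 0) = c1" using c1g by auto
    show ?thesis
    proof (cases "g \<in> H")
      case gH: True
      have fy1: "free c1 y1 b" if "free (c(g := 0)) y1 b" "b \<noteq> 0" for b
        using fp[OF neq(1) neq(3)[symmetric] that] c1g0 by simp
      show ?thesis
        by (rule exI[of _ g], rule exI[of _ y1], rule exI[of _ c1])
          (intro conjI allI impI, use gH g c1g col1 z1 fr o rr1 fy1 in \<open>simp_all del: fun_upd_apply\<close>)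
    next
      case gH: False
      have "g \<notin> zeros c" using a unfolding a_def zeros_def by auto
      then have zz: "zeros c' = insert g' (zeros c - {f})"
        using IH(7) z1 by auto
      have hh: "c1 h = c h" if "h \<in> H" for h using that fH gH unfolding c1_def by auto
      have rr: "c' h = c h" if "r \<notin> ends G h" for h
        using IH(6) that rr1 by simp
      have "p \<noteq> x" "p \<noteq> r" using IH(1,4,5) Cons.prems(2) ends_neq by auto
      then have fp': "free c' p b" if "free (c(g' := 0)) p b" "b \<noteq> 0" for b
        using that IH(10) fp by blast
      show ?thesis
        by (rule exI[of _ g'], rule exI[of _ p], rule exI[of _ c'])
          (intro conjI allI impI, use IH(1-5,8,9,11) fr fp' o zz hh rr in \<open>simp_all del: fun_upd_apply\<close>)
    qed
  qed
qed

lemma hole_move: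
  assumes "(fan_step c r)\<^sup>*\<^sup>* x y" "partial_colouring c" "f \<in> edges G" "c f = 0" "ends G f = {x, r}"
  obtains g p c' where "g \<in> edges G" "partial_colouring c'" "c' g = 0" "ends G g = {r, p}"
    "\<And>h. r \<notin> ends G h \<Longrightarrow> c' h = c h" "zeros c' = insert g (zeros c - {f})" "ones c' = ones c"
    "\<And>a. free c r a \<Longrightarrow> a \<noteq> 0 \<Longrightarrow> free c' r a"
    "\<And>a. a \<noteq> 0 \<Longrightarrow> free (c(g := 0)) p a \<Longrightarrow> free c' p a"
    "g \<in> H \<or> p = y \<and> (\<forall>h \<in> H. c' h = c h)"
proof -
  obtain xs where "rtrancl_path (fan_step c r) x xs y"
    using assms(1) unfolding rtranclp_eq_rtrancl_path by blast
  then obtain ys where ys: "rtrancl_path (fan_step c r) x ys y" "distinct (x # ys)"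
    by (rule rtrancl_path_distinct)
  show thesis
    using hole_move_path[OF ys assms(2-5), of H] that by blast
qed

lemma fan_reach_verts:
  assumes "(fan_step c r)\<^sup>*\<^sup>* x y" "f \<in> edges G" "ends G f = {x, r}"
  shows "\<exists>g \<in> edges G. ends G g = {r, y}"
  using assms by (induction rule: rtranclp_induct) (auto simp: fan_step_def insert_commute)


text \<open>Once the hole is shifted to \<open>y\<close>, it could take the colour \<open>b\<close>,
  leaving fewer uncoloured edges with the same class of colour \<open>1\<close>.\<close>

lemma fan_disjoint_centre:
  assumes "partial_colouring c" "irreducible c" "f \<in> edges G" "c f = 0" "ends G f = {x, r}"
    and "(fan_step c r)\<^sup>*\<^sup>* x y" "b \<in> miss c y" "b \<in> miss c r"
  shows False
proof -
  obtain g c' where g: "g \<in> edges G" "partial_colouring c'" "c' g = 0" "ends G g = {r, y}"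
    "zeros c' = insert g (zeros c - {f})" "ones c' = ones c"
    "\<And>a. free c r a \<Longrightarrow> a \<noteq> 0 \<Longrightarrow> free c' r a"
    "\<And>a. a \<noteq> 0 \<Longrightarrow> free (c(g := 0)) y a \<Longrightarrow> free c' y a"
    by (rule hole_move[OF assms(6,1,3,4,5), where H = "{}"]) blast
  have b: "2 \<le> b" "b \<le> \<Delta> + \<mu>" "free c y b" "free c r b" using assms(7,8) unfolding miss_def by auto
  have "partial_colouring (c'(g := b))"
    using g b free_upd[OF b(3), of g 0] by (intro partial_colouring_colour[of _ _ r y]) auto
  moreover have "ones (c'(g := b)) = ones c'"
    using g(3) b unfolding ones_def by auto
  moreover have "zeros (c'(g := b)) = zeros c' - {g}"
    using b unfolding zeros_def by auto
  ultimately have "card (zeros c) \<le> card (zeros c' - {g})"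
    using assms(2) g(6) unfolding irreducible_def by metis
  also have "\<dots> \<le> card (zeros c - {f})"
    using g(5) finite_zeros by (intro card_mono) auto
  also have "\<dots> < card (zeros c)"
    using assms(3,4) finite_zeros by (intro psubset_card_mono) (auto simp: zeros_def)
  finally show False by simp
qed

text \<open>A fan step can be destroyed only if its colour is \<open>a\<close> and its starting
  vertex lies in \<open>S\<close>, but that vertex then misses \<open>b\<close> after the exchange.
  So the first vertex on the path that misses \<open>b\<close> afterwards stays reachable.\<close>

lemma kempe_swap_fan_reach:
  assumes "kempe_closed c a b S" "a \<noteq> b" "a \<in> {2..\<Delta> + \<mu>}" "b \<in> {2..\<Delta> + \<mu>}"
    and "(fan_step c r)\<^sup>*\<^sup>* x y" "r \<notin> S" "free c r b" "b \<in> miss (kempe_swap S a b c) y"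
  shows "\<exists>y'. (fan_step (kempe_swap S a b c) r)\<^sup>*\<^sup>* x y' \<and> b \<in> miss (kempe_swap S a b c) y'"
  using assms(5)
proof (induction rule: converse_rtranclp_induct)
  case base
  then show ?case using assms(8) by blast
next
  case (step p p')
  let ?c = "kempe_swap S a b c"
  obtain g where g: "g \<in> edges G" "ends G g = {r, p'}" "c g \<in> miss c p"
    using step.hyps(1) unfolding fan_step_def by blast
  show ?case
  proof (cases "b \<in> miss ?c p")
    case True
    then show ?thesis by blast
  next
    case False
    have cgb: "c g \<noteq> b" using assms(7) g unfolding free_def by auto
    have "c g \<in> miss ?c p"
    proof (cases "p \<in> S \<and> c g = a")
      case True
      then have "b \<in> miss ?c p"
        using g(3) free_kempe_swap(2)[OF assms(1,2)] assms(4) unfolding miss_def by auto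
      with False show ?thesis by blast
    next
      case nF: False
      show ?thesis
      proof (cases "p \<in> S")
        case True
        with nF have "c g \<notin> {a, b}" using cgb by auto
        then show ?thesis using g(3) free_kempe_swap(4)[OF assms(1,2)] unfolding miss_def by auto
      next
        case False
        then show ?thesis using g(3) free_kempe_swap(3)[OF assms(1,2)] unfolding miss_def by auto
      qed
    qed
    moreover have "?c g = c g"
    proof (cases "c g = a")
      case True
      then have "ends G g \<inter> S = {}" using assms(1,6) g unfolding kempe_closed_def by auto
      then show ?thesis by (simp add: kempe_swap_def)
    qed (use cgb in \<open>simp add: kempe_swap_def\<close>)
    ultimately have "fan_step ?c r p p'" using g unfolding fan_step_def by auto
    then show ?thesis using step.IH by (meson converse_rtranclp_into_rtranclp)
  qed
qed

text \<open>Take \<open>b\<close> missing at the centre. Some closed set around \<open>r\<close>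
  avoids \<open>y1\<close> or \<open>y2\<close>; exchanging \<open>a\<close> and \<open>b\<close>
  outside it makes \<open>b\<close> missing at that vertex while \<open>r\<close> still misses
  \<open>b\<close>, against \<open>fan_disjoint_centre\<close>.\<close>

lemma fan_elementary:
  assumes "partial_colouring c" "irreducible c" "f \<in> edges G" "c f = 0" "ends G f = {x, r}"
    and "(fan_step c r)\<^sup>*\<^sup>* x y1" "(fan_step c r)\<^sup>*\<^sup>* x y2" "y1 \<noteq> y2"
    and "a \<in> miss c y1" "a \<in> miss c y2"
  shows False
proof -
  have vr: "r \<in> verts G" using assms(3,5) ends_verts by blast
  have "\<mu> \<ge> 1" using multiplicity_pos assms(3) by blast
  moreover have "card {g \<in> zeros c. r \<in> ends G g} \<ge> 1"
  proof -
    have "f \<in> {g \<in> zeros c. r \<in> ends G g}" using assms(3-5) by (auto simp: zeros_def)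
    then have "card {g \<in> zeros c. r \<in> ends G g} \<noteq> 0"
      using finite_zeros[of c] by (metis (no_types, lifting) card_0_eq emptyE finite_subset mem_Collect_eq subsetI)
    then show ?thesis by simp
  qed
  ultimately have "card (miss c r) \<ge> 1" using card_miss_ge[OF assms(1) vr] by linarith
  then obtain b where b: "b \<in> miss c r" by fastforce
  have ab: "a \<noteq> b" using fan_disjoint_centre[OF assms(1-6)] assms(9) b by blast
  have rng: "a \<in> {2..\<Delta> + \<mu>}" "b \<in> {2..\<Delta> + \<mu>}" using assms(9) b unfolding miss_def by auto
  have fr: "free c r b" "free c y1 a" "free c y2 a" using b assms(9,10) unfolding miss_def by auto
  have "a \<notin> miss c r" using fan_disjoint_centre[OF assms(1-6)] assms(9) by blast
  then have dist: "distinct [r, y1, y2]" using assms(8-10) by auto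
  have vs: "{r, y1, y2} \<subseteq> verts G"
    using fan_reach_verts[OF assms(6,3,5)] fan_reach_verts[OF assms(7,3,5)] ends_verts by fastforce
  obtain T where T: "kempe_closed c a b T" "r \<in> T" "y1 \<notin> T \<or> y2 \<notin> T"
    using exists_kempe_closed_avoiding[OF assms(1) ab _ _ fr dist vs] rng by auto
  define S where "S = verts G - T"
  have clS: "kempe_closed c a b S"
    using T(1) ends_in_verts unfolding kempe_closed_def S_def by blast
  obtain y where y: "y \<in> {y1, y2}" "y \<in> S" using T(3) vs unfolding S_def by auto
  let ?c = "kempe_swap S a b c"
  have yr: "(fan_step c r)\<^sup>*\<^sup>* x y" "free c y a" using y assms(6,7) fr by auto
  have "b \<in> miss ?c y"
    using free_kempe_swap(2)[OF clS ab y(2)] yr(2) rng unfolding miss_def by auto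
  then obtain y' where y': "(fan_step ?c r)\<^sup>*\<^sup>* x y'" "b \<in> miss ?c y'"
    using kempe_swap_fan_reach[OF clS ab rng yr(1) _ fr(1)] T(2) unfolding S_def by blast
  have "partial_colouring ?c" using partial_colouring_kempe_swap[OF assms(1) clS] rng by auto
  moreover have "irreducible ?c"
  proof -
    have "ones ?c = ones c" using rng unfolding ones_def kempe_swap_def by auto
    moreover have "zeros ?c = zeros c" using zeros_kempe_swap rng by auto
    ultimately show ?thesis using assms(2) unfolding irreducible_def by simp
  qed
  moreover have "?c f = 0" using assms(4) rng by (simp add: kempe_swap_def)
  moreover have "b \<in> miss ?c r"
    using free_kempe_swap(3)[OF clS ab, of r] T(2) b unfolding miss_def S_def by auto
  ultimately show False using fan_disjoint_centre[OF _ _ assms(3) _ assms(5) y'] by blast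
qed

text \<open>The missing sets of fan vertices are disjoint, and each of their colours occurs at
  \<open>r\<close> on a coloured edge to a fan vertex; so they have fewer than
  \<open>card X * \<mu>\<close> colours in total. By \<open>card_miss_ge\<close> each vertex misses
  at least \<open>\<mu> - 1\<close> colours, one more if it sees colour \<open>1\<close>, and one
  more at \<open>x\<close> because of the hole. Comparing the sums leaves two vertices that do not
  see \<open>1\<close>.\<close>

lemma fan_two_free:
  assumes "partial_colouring c" "irreducible c" "f \<in> edges G" "c f = 0" "ends G f = {x, r}"
  shows "2 \<le> card {y. (fan_step c r)\<^sup>*\<^sup>* x y \<and> free c y 1}"
proof -
  define X where "X = {y. (fan_step c r)\<^sup>*\<^sup>* x y}"
  have vr: "r \<in> verts G" using assms(3,5) ends_verts by blast
  have Xv: "X \<subseteq> verts G"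
    using fan_reach_verts[OF _ assms(3,5)] ends_verts unfolding X_def by blast
  then have finX: "finite X" using finite_verts finite_subset by blast
  have xX: "x \<in> X" unfolding X_def by simp
  define R where "R = (\<Union>y\<in>X. {g \<in> edges G. ends G g = {r, y}})"
  have finR: "finite R" unfolding R_def using finX finite_edges by auto
  have finM: "finite (miss c y)" for y unfolding miss_def by simp
  have fR: "f \<in> R" using xX assms(3,5) unfolding R_def by (auto simp: insert_commute)
  have "card R \<le> (\<Sum>y\<in>X. card {g \<in> edges G. ends G g = {r, y}})"
    unfolding R_def by (rule card_UN_le[OF finX])
  also have "\<dots> \<le> (\<Sum>y\<in>X. \<mu>)"
    using multiplicity_le[OF vr] Xv unfolding multiplicity_def by (intro sum_mono) auto
  finally have cR: "card R \<le> card X * \<mu>" by simp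
  have "(\<Union>y\<in>X. miss c y) \<subseteq> c ` (R - {f})"
  proof
    fix a assume "a \<in> (\<Union>y\<in>X. miss c y)"
    then obtain y where y: "(fan_step c r)\<^sup>*\<^sup>* x y" "a \<in> miss c y" unfolding X_def by blast
    then have "a \<notin> miss c r" using fan_disjoint_centre[OF assms y(1)] by blast
    then have "\<not> free c r a" using y(2) unfolding miss_def by auto
    then obtain g where g: "g \<in> edges G" "r \<in> ends G g" "c g = a" by (rule not_free_obtain)
    obtain y' where y': "ends G g = {r, y'}" using ends_cases[OF g(1,2)] by metis
    have "fan_step c r y y'" using g y y' unfolding fan_step_def by auto
    then have "y' \<in> X" using y(1) unfolding X_def by auto
    moreover have "g \<noteq> f" using g(3) y(2) assms(4) unfolding miss_def by auto
    ultimately show "a \<in> c ` (R - {f})" using g y' unfolding R_def by auto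
  qed
  then have "card (\<Union>y\<in>X. miss c y) \<le> card (R - {f})"
    using finR by (meson card_image_le card_mono finite_Diff finite_imageI le_trans)
  moreover have "card (\<Union>y\<in>X. miss c y) = (\<Sum>y\<in>X. card (miss c y))"
    using finX finM fan_elementary[OF assms] unfolding X_def
    by (intro card_UN_disjoint) auto
  \<comment> \<open>\<open>f\<close> joins \<open>r\<close> to a fan vertex but is uncoloured, which
    makes the bound strict.\<close>
  moreover have "card (R - {f}) < card R" using fR finR by (rule card_Diff1_less[rotated])
  ultimately have up: "(\<Sum>y\<in>X. card (miss c y)) < card X * \<mu>" using cR by linarith
  let ?n = "\<lambda>y. if free c y 1 then 0 else 1::nat"
  have one: "\<mu> + ?n y + (if y = x then 1 else 0) \<le> card (miss c y) + 1" if "y \<in> X" for y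
  proof -
    have "(if y = x then 1 else 0) \<le> card {g \<in> zeros c. y \<in> ends G g}"
    proof (cases "y = x")
      case True
      then have "f \<in> {g \<in> zeros c. y \<in> ends G g}" using assms(3-5) by (auto simp: zeros_def)
      moreover have "finite {g \<in> zeros c. y \<in> ends G g}" using finite_zeros by simp
      ultimately have "card {g \<in> zeros c. y \<in> ends G g} > 0" using card_gt_0_iff by blast
      then show ?thesis by (simp add: True Suc_le_eq)
    qed simp
    moreover have "y \<in> verts G" using that Xv by blast
    ultimately show ?thesis using card_miss_ge[OF assms(1), of y] by linarith
  qed
  have "(\<Sum>y\<in>X. \<mu> + ?n y + (if y = x then 1 else 0)) \<le> (\<Sum>y\<in>X. card (miss c y) + 1)"
    by (intro sum_mono one)
  then have "card X * \<mu> + (\<Sum>y\<in>X. ?n y) + 1 \<le> (\<Sum>y\<in>X. card (miss c y)) + card X"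
    using finX xX unfolding sum.distrib by (simp add: sum.delta)
  moreover have "(\<Sum>y\<in>X. ?n y) + card {y \<in> X. free c y 1} = card X"
  proof -
    have "(\<Sum>y\<in>X. ?n y) = card {y \<in> X. \<not> free c y 1}"
      using finX by (simp add: sum.If_cases Int_def)
    moreover have "card X = card ({y \<in> X. \<not> free c y 1} \<union> {y \<in> X. free c y 1})"
      by (rule arg_cong[where f = card]) auto
    moreover have "\<dots> = card {y \<in> X. \<not> free c y 1} + card {y \<in> X. free c y 1}"
      using finX by (intro card_Un_disjoint) auto
    ultimately show ?thesis by simp
  qed
  ultimately have "2 \<le> card {y \<in> X. free c y 1}" using up by linarith
  then show ?thesis unfolding X_def by simp
qed

lemma fan_free_avoiding:
  assumes "partial_colouring c" "irreducible c" "f \<in> edges G" "c f = 0" "ends G f = {x, r}"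
  obtains y where "(fan_step c r)\<^sup>*\<^sup>* x y" "free c y 1" "y \<noteq> s"
proof -
  let ?Y = "{y. (fan_step c r)\<^sup>*\<^sup>* x y \<and> free c y 1}"
  have "\<not> ?Y \<subseteq> {s}"
  proof
    assume "?Y \<subseteq> {s}"
    then have "card ?Y \<le> card {s}" by (intro card_mono) auto
    then show False using fan_two_free[OF assms] by simp
  qed
  then show thesis using that by blast
qed

end

subsection \<open>Colourings with few edges of colour 1\<close>

locale precoloured = palette G \<Delta> \<mu> for G :: "('v, 'e) mgraph" and \<Delta> \<mu> +
  fixes M :: "'e set" and pre :: "'e \<Rightarrow> nat"
  assumes M_edges: "M \<subseteq> edges G"
    and far: "e \<in> M \<Longrightarrow> f \<in> M \<Longrightarrow> e \<noteq> f \<Longrightarrow> 9 \<le> edge_distance G e f"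
    and pre_range: "e \<in> M \<Longrightarrow> pre e \<in> {1..\<Delta> + \<mu>}"
begin

section \<open>Balls around an edge\<close>

primrec ball :: "nat \<Rightarrow> 'e \<Rightarrow> 'v set" where
  "ball 0 e = ends G e"
| "ball (Suc n) e = ball n e \<union> {y. \<exists>g \<in> edges G. \<exists>x \<in> ball n e. ends G g = {x, y}}"

lemma ball_mono: "m \<le> n \<Longrightarrow> ball m e \<subseteq> ball n e"
  by (rule lift_Suc_mono_le[where f = "\<lambda>n. ball n e"]) auto

lemma ball_verts: "e \<in> edges G \<Longrightarrow> ball n e \<subseteq> verts G"
  using ends_in_verts by (induction n) auto

lemma ball_step:
  assumes "g \<in> edges G" "ends G g = {x, y}" "x \<in> ball m e" "m < n"
  shows "y \<in> ball n e"
proof -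
  have "y \<in> ball (Suc m) e" using assms(1-3) by auto
  then show ?thesis using ball_mono[of "Suc m" n e] assms(4) by auto
qed

lemma ball_edge:
  assumes "g \<in> edges G" "x \<in> ends G g" "x \<in> ball m e" "m < n"
  shows "ends G g \<subseteq> ball n e"
proof -
  obtain y where y: "ends G g = {x, y}" using ends_cases[OF assms(1,2)] by metis
  moreover have "x \<in> ball n e" using ball_mono[of m n e] assms(3,4) by auto
  ultimately show ?thesis using ball_step[OF assms(1) y assms(3,4)] by auto
qed

lemma ball_path:
  assumes "e \<in> edges G" "y \<in> ball n e"
  shows "\<exists>p. path G p \<and> hd p \<in> ends G e \<and> last p = y \<and> length p \<le> Suc n"
  using assms(2)
proof (induction n arbitrary: y)
  case 0
  then show ?case using assms(1) ends_verts
    by (intro exI[of _ "[y]"]) (auto simp: path_def)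
next
  case (Suc n)
  show ?case
  proof (cases "y \<in> ball n e")
    case True
    then show ?thesis using Suc.IH by (metis le_SucI)
  next
    case False
    then obtain g x where gx: "g \<in> edges G" "x \<in> ball n e" "ends G g = {x, y}" using Suc.prems by auto
    then obtain p where p: "path G p" "hd p \<in> ends G e" "last p = x" "length p \<le> Suc n"
      using Suc.IH by blast
    show ?thesis
    proof (cases "y \<in> set p")
      case True
      \<comment> \<open>\<open>path\<close> demands distinct vertices, so a path that already visits
        \<open>y\<close> is cut at \<open>y\<close>.\<close>
      then obtain xs ys where xy: "p = (xs @ [y]) @ ys" by (metis append.assoc append_Cons append_Nil split_list)
      have "path G (xs @ [y])"
        using p(1) unfolding path_def xy by (auto simp: successively_append_iff)
      moreover have "hd (xs @ [y]) = hd p" unfolding xy by (cases xs) auto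
      moreover have "length (xs @ [y]) \<le> length p" unfolding xy by simp
      ultimately show ?thesis using p by (intro exI[of _ "xs @ [y]"]) auto
    next
      case False
      have "adjacent G x y" using gx unfolding adjacent_def by auto
      moreover have "y \<in> verts G" using gx ends_verts by auto
      ultimately have "path G (p @ [y])"
        using p False unfolding path_def by (auto simp: successively_append_iff)
      then show ?thesis using p by (intro exI[of _ "p @ [y]"]) (auto simp: path_def)
    qed
  qed
qed

lemma ball_meet:
  assumes "y \<in> ball i e" "y \<in> ball j f"
  shows "\<exists>z \<in> ends G f. z \<in> ball (i + j) e"
  using assms
proof (induction j arbitrary: i y)
  case (Suc j)
  show ?case
  proof (cases "y \<in> ball j f")
    case True
    then obtain z where z: "z \<in> ends G f" "z \<in> ball (i + j) e" using Suc by blast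
    then show ?thesis using ball_mono[of "i + j" "i + Suc j" e] by auto
  next
    case False
    then obtain g x where gx: "g \<in> edges G" "x \<in> ball j f" "ends G g = {x, y}" using Suc.prems(2) by auto
    then have "ends G g = {y, x}" by auto
    then have "x \<in> ball (Suc i) e" using ball_step[OF gx(1) _ Suc.prems(1) lessI] by blast
    then show ?thesis using Suc.IH[of x "Suc i"] gx by simp
  qed
qed auto

text \<open>The distance bound \<open>9\<close> enters only here. Its tightest use is with radii
  \<open>3\<close> and \<open>5\<close>, in \<open>prepared_persists\<close>.\<close>

lemma ball_far:
  assumes "e \<in> M" "f \<in> M" "e \<noteq> f" "y \<in> ball i e" "y \<in> ball j f"
  shows "9 \<le> i + j"
proof -
  obtain z where z: "z \<in> ends G f" "z \<in> ball (i + j) e" using ball_meet assms by blast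
  then obtain p where p: "path G p" "hd p \<in> ends G e" "last p = z" "length p \<le> Suc (i + j)"
    using ball_path M_edges assms(1) by blast
  have "edge_distance G e f \<le> enat (length p - 1)"
    unfolding edge_distance_def using p z by (intro INF_lower) auto
  also have "\<dots> \<le> enat (i + j)" using p(4) by auto
  finally have "9 \<le> enat (i + j)" using far[OF assms(1-3)] by order
  then show ?thesis by (simp add: numeral_eq_enat)
qed

lemma M_in_ball:
  assumes "e \<in> M" "f \<in> M" "x \<in> ends G f" "x \<in> ball n e" "n < 9"
  shows "f = e"
  using ball_far[OF assms(1,2), of x n 0] assms by fastforce

text \<open>Colour a maximal matching containing \<open>M\<close> with \<open>1\<close>; an uncoloured edge can be moved to a vertex free
  of colour \<open>1\<close>, whose fan would contain an edge extending the matching.\<close>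

lemma exists_full:
  shows "\<exists>c. partial_colouring c \<and> zeros c = {} \<and> M \<subseteq> ones c"
proof -
  define matching where "matching A \<longleftrightarrow> M \<subseteq> A \<and> A \<subseteq> edges G \<and>
    (\<forall>g \<in> A. \<forall>h \<in> A. g \<noteq> h \<longrightarrow> ends G g \<inter> ends G h = {})" for A
  have "matching M"
    unfolding matching_def
  proof (intro conjI ballI impI subset_refl M_edges)
    fix g h assume gh: "g \<in> M" "h \<in> M" "g \<noteq> h"
    show "ends G g \<inter> ends G h = {}"
      using ball_far[OF gh, of _ 0 0] by fastforce
  qed
  moreover have "\<forall>A. matching A \<longrightarrow> card A < Suc (card (edges G))"
    unfolding matching_def using card_mono[OF finite_edges] by (auto simp: less_Suc_eq_le)
  ultimately have "\<exists>A. matching A \<and> (\<forall>A'. matching A' \<longrightarrow> card A' \<le> card A)"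
    by (rule ex_has_greatest_nat)
  then obtain A where A: "matching A" and Amax: "\<And>A'. matching A' \<Longrightarrow> card A' \<le> card A" by metis
  define P where "P c \<longleftrightarrow> partial_colouring c \<and> ones c = A" for c
  \<comment> \<open>Leaving everything outside \<open>A\<close> uncoloured shows that
    \<open>P\<close> can be satisfied; \<open>c\<close> then has the fewest uncoloured
    edges.\<close>
  have "P (\<lambda>g. if g \<in> A then 1 else 0)"
    using A multiplicity_pos unfolding P_def partial_colouring_def ones_def matching_def by force
  then obtain c where c: "P c" and cmin: "\<And>c'. P c' \<Longrightarrow> card (zeros c) \<le> card (zeros c')"
    using ex_has_least_nat[of P _ "\<lambda>c. card (zeros c)"] by metis
  have no_free_edge: False
    if "g \<in> edges G" "ends G g = {x, y}" "free c' x 1" "free c' y 1" "P c'" for g x y c'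
  proof -
    have d: "ends G g \<inter> ends G h = {}" if "h \<in> A" for h
      using \<open>P c'\<close> \<open>ends G g = {x, y}\<close> \<open>free c' x 1\<close> \<open>free c' y 1\<close> that
      unfolding P_def free_def ones_def by auto
    then have "g \<notin> A" using that(2) by auto
    have "matching (insert g A)"
      using A d \<open>g \<in> edges G\<close> unfolding matching_def by blast
    moreover have "finite A" using A finite_subset[OF _ finite_edges] unfolding matching_def by simp
    ultimately show False using Amax[of "insert g A"] \<open>g \<notin> A\<close> by simp
  qed
  \<comment> \<open>The fan of such a hole has a vertex that does not see \<open>1\<close> either,
    and the fan edge from it to the centre could be added to the matching.\<close>
  have no_free_centre: False
    if hyps: "f \<in> edges G" "c' f = 0" "ends G f = {x, r}" "free c' r 1" "P c'" "irreducible c'"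
    for f x r c'
  proof -
    have "partial_colouring c'" using hyps(5) unfolding P_def by simp
    then obtain y where y: "(fan_step c' r)\<^sup>*\<^sup>* x y" "free c' y 1"
      by (rule fan_free_avoiding[OF _ hyps(6,1-3)]) blast
    then show False using fan_reach_verts[OF y(1) hyps(1,3)] no_free_edge hyps by blast
  qed
  have irr: "irreducible c'" if "P c'" "card (zeros c') \<le> card (zeros c)" for c'
    using that cmin unfolding irreducible_def P_def by (auto intro: le_trans)
  have "zeros c = {}"
  proof (rule ccontr)
    assume "zeros c \<noteq> {}"
    then obtain f where f: "f \<in> edges G" "c f = 0" unfolding zeros_def by auto
    obtain x r where xr: "ends G f = {x, r}" using card_ends[OF f(1)] by (auto simp: card_2_iff)
    have pc: "partial_colouring c" using c unfolding P_def by simp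
    have "irreducible c" using irr c by simp
    then obtain y where y: "(fan_step c r)\<^sup>*\<^sup>* x y" "free c y 1"
      by (rule fan_free_avoiding[OF pc _ f xr]) blast
    \<comment> \<open>After the shift \<open>y\<close> is an end of the hole, so the fan can be
      centred at \<open>y\<close>, which does not see \<open>1\<close>.\<close>
    obtain g c' where g: "g \<in> edges G" "partial_colouring c'" "c' g = 0"
      "zeros c' = insert g (zeros c - {f})" "ones c' = ones c" "ends G g = {r, y}"
      by (rule hole_move[OF y(1) pc f xr, where H = "{}"]) blast
    have "f \<in> zeros c" using f unfolding zeros_def by simp
    then have "Suc (card (zeros c - {f})) = card (zeros c)"
      using finite_zeros by (intro card_Suc_Diff1)
    then have "card (zeros c') \<le> card (zeros c)"
      unfolding g(4) using finite_zeros[of c] by (auto simp: card_insert_if)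
    moreover have "P c'" using g c unfolding P_def by simp
    moreover have "free c' y 1" using free_one_iff[OF g(5)] y(2) by simp
    ultimately show False using no_free_centre[of g c' r y] irr[of c'] g by auto
  qed
  then show ?thesis using c A unfolding P_def matching_def by blast
qed

section \<open>Minimal colourings and filling a hole\<close>

definition minimal :: "('e \<Rightarrow> nat) \<Rightarrow> bool" where
  "minimal c \<longleftrightarrow> partial_colouring c \<and> zeros c = {} \<and> M \<subseteq> ones c \<and>
     (\<forall>c'. partial_colouring c' \<longrightarrow> zeros c' = {} \<longrightarrow> M \<subseteq> ones c' \<longrightarrow> card (ones c) \<le> card (ones c'))"

lemma exists_minimal: "\<exists>c. minimal c"
proof -
  obtain c0 where "partial_colouring c0 \<and> zeros c0 = {} \<and> M \<subseteq> ones c0" using exists_full by blast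
  then show ?thesis
    using ex_has_least_nat[of "\<lambda>c. partial_colouring c \<and> zeros c = {} \<and> M \<subseteq> ones c" c0 "\<lambda>c. card (ones c)"]
    unfolding minimal_def by blast
qed

lemma minimalD:
  assumes "minimal c"
  shows "partial_colouring c" "zeros c = {}" "M \<subseteq> ones c" "e \<in> M \<Longrightarrow> c e = 1" "g \<in> edges G \<Longrightarrow> c g \<noteq> 0"
  using assms unfolding minimal_def ones_def zeros_def by auto

text \<open>Colouring the hole without changing the class of colour \<open>1\<close> would give a
  complete colouring with fewer edges of colour \<open>1\<close> than \<open>c\<close>.\<close>

lemma minimal_hole_irreducible:
  assumes "minimal c" "zeros c' = {f}" "M \<subseteq> ones c'" "card (ones c') < card (ones c)"
  shows "irreducible c'"
  unfolding irreducible_def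
proof (intro allI impI)
  fix c'' assume c'': "partial_colouring c''" "ones c'' = ones c'"
  then have "zeros c'' \<noteq> {}"
    using assms unfolding minimal_def by (metis leD)
  then have "0 < card (zeros c'')" using finite_zeros by (simp add: card_gt_0_iff)
  then show "card (zeros c') \<le> card (zeros c'')" using assms(2) by simp
qed

text \<open>The first alternative lets a shift stop early, at an edge of \<open>H\<close>.\<close>

lemma hole_fill:
  assumes "minimal c" "partial_colouring c'" "zeros c' = {f}" "M \<subseteq> ones c'" "Suc (card (ones c')) = card (ones c)"
    and "ends G f = {x, r}" "free c' r 1" "(fan_step c' r)\<^sup>*\<^sup>* x y" "free c' y 1"
  obtains
    (hit) g p c1 where "g \<in> H" "ends G g = {r, p}" "partial_colouring c1" "zeros c1 = {g}" "ones c1 = ones c'"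
      "\<And>h. r \<notin> ends G h \<Longrightarrow> c1 h = c' h"
      "\<And>a. a \<noteq> 0 \<Longrightarrow> free (c'(g := 0)) p a \<Longrightarrow> free c1 p a"
  | (fill) g c1 where "g \<in> edges G" "ends G g = {r, y}" "minimal c1" "c1 g = 1"
      "ones c1 = insert g (ones c')" "\<And>h. r \<notin> ends G h \<Longrightarrow> c1 h = c' h"
      "\<And>h. h \<in> H \<Longrightarrow> c1 h = c' h" "\<And>a. free c' r a \<Longrightarrow> 2 \<le> a \<Longrightarrow> free c1 r a"
proof -
  have f: "f \<in> edges G" "c' f = 0" using assms(3) unfolding zeros_def by auto
  obtain g p c1 where g: "g \<in> edges G" "partial_colouring c1" "c1 g = 0" "ends G g = {r, p}"
    "\<And>h. r \<notin> ends G h \<Longrightarrow> c1 h = c' h" "zeros c1 = insert g (zeros c' - {f})" "ones c1 = ones c'"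
    "\<And>a. free c' r a \<Longrightarrow> a \<noteq> 0 \<Longrightarrow> free c1 r a"
    "\<And>a. a \<noteq> 0 \<Longrightarrow> free (c'(g := 0)) p a \<Longrightarrow> free c1 p a"
    "g \<in> H \<or> p = y \<and> (\<forall>h \<in> H. c1 h = c' h)"
    by (rule hole_move[OF assms(8,2) f assms(6), where H = H]) blast
  show thesis
  proof (cases "g \<in> H")
    case True
    then show thesis using hit[of g p c1] g assms(3) by auto
  next
    case False
    then have gy: "ends G g = {r, y}" "\<And>h. h \<in> H \<Longrightarrow> c1 h = c' h" using g(4,10) by auto
    have fr: "free c1 r 1" "free c1 y 1"
      using free_one_iff[OF g(7)] assms(7,9) by auto
    have D: "1 \<le> \<Delta> + \<mu>" using multiplicity_pos[OF f(1)] by simp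
    let ?c = "c1(g := 1)"
    have p: "partial_colouring ?c" using partial_colouring_colour[OF g(2) gy(1) fr D] .
    have z: "zeros ?c = {}" using g(6) assms(3) unfolding zeros_def by auto
    have o: "ones ?c = insert g (ones c')" using g(1,7) unfolding ones_def by auto
    \<comment> \<open>Filling the hole only restores the number of \<open>1\<close>-edges, so the
      new colouring is again minimal.\<close>
    have "card (ones ?c) \<le> card (ones c)"
      unfolding o using assms(5) finite_ones by (metis card_insert_le_m1 diff_Suc_1 le_refl zero_less_Suc)
    then have gd: "minimal ?c"
      using p z o assms(1,4) unfolding minimal_def by (metis le_trans subset_insertI2)
    show thesis
    proof (rule fill[OF g(1) gy(1) gd _ o])
      show "?c h = c' h" if "r \<notin> ends G h" for h using that g(4,5) by auto
      show "?c h = c' h" if "h \<in> H" for h using that gy(2) False by auto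
      show "free ?c r a" if "free c' r a" "2 \<le> a" for a
        using that g(8)[of a] by (intro free_upd) auto
    qed simp
  qed
qed


text \<open>The colouring solving the problem for \<open>e\<close> may recolour \<open>e\<close>, so it is not minimal in general;
  \<open>success\<close> records a minimal colouring from which it is reached.\<close>

definition prepared :: "('e \<Rightarrow> nat) \<Rightarrow> 'e \<Rightarrow> bool" where
  "prepared c e \<longleftrightarrow> (\<exists>c'. partial_colouring c' \<and> zeros c' = {} \<and> c' e = pre e \<and>
     (\<forall>g \<in> edges G. c' g \<noteq> c g \<longrightarrow> ends G g \<subseteq> ball 3 e))"

definition success :: "('e \<Rightarrow> nat) \<Rightarrow> 'e \<Rightarrow> bool" where
  "success c e \<longleftrightarrow> (\<exists>c'. minimal c' \<and> prepared c' e \<and>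
     (\<forall>g \<in> edges G. c' g \<noteq> c g \<longrightarrow> ends G g \<subseteq> ball 5 e))"

lemma prepared_success: "minimal c \<Longrightarrow> prepared c e \<Longrightarrow> success c e"
  unfolding success_def by auto

lemma success_trans:
  assumes "success c' e" "\<And>g. g \<in> edges G \<Longrightarrow> c' g \<noteq> c g \<Longrightarrow> ends G g \<subseteq> ball 5 e"
  shows "success c e"
  using assms unfolding success_def by metis

text \<open>\<open>D\<close> collects exceptional edges through which a chain may leave \<open>S\<close>.\<close>

definition sealed :: "('e \<Rightarrow> nat) \<Rightarrow> nat \<Rightarrow> 'v set \<Rightarrow> 'e set \<Rightarrow> bool" where
  "sealed c a S D \<longleftrightarrow>
     (\<forall>g \<in> edges G - D. c g \<in> {1, a} \<longrightarrow> ends G g \<inter> S \<noteq> {} \<longrightarrow> ends G g \<subseteq> S)"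

lemma sealedD:
  "sealed c a S D \<Longrightarrow> g \<in> edges G \<Longrightarrow> g \<notin> D \<Longrightarrow> c g \<in> {1, a} \<Longrightarrow> y \<in> ends G g \<Longrightarrow> y \<in> S \<Longrightarrow> ends G g \<subseteq> S"
  unfolding sealed_def by blast

lemma sealed_kempe_closed:
  assumes "sealed c a S D" "\<And>g. g \<in> edges G \<Longrightarrow> c' g \<in> {1, a} \<Longrightarrow> g \<notin> D \<and> c g = c' g"
  shows "kempe_closed c' 1 a S"
  using assms unfolding sealed_def kempe_closed_def by fastforce

end

subsection \<open>A single precoloured edge\<close>

text \<open>\<open>gu\<close> and \<open>gv\<close> are meant as the edges of colour
  \<open>pre e\<close> at the ends of \<open>e\<close>. Their colours are left to
  \<open>ready\<close>, because the colouring varies while the configuration stays fixed.\<close>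

locale configuration = precoloured G \<Delta> \<mu> M pre for G :: "('v, 'e) mgraph" and \<Delta> \<mu> M pre +
  fixes e gu gv :: 'e and u v w z :: 'v
  assumes eM: "e \<in> M" and ends_e: "ends G e = {u, v}"
    and gu: "gu \<in> edges G" "ends G gu = {u, w}"
    and gv: "gv \<in> edges G" "ends G gv = {v, z}"
    and dist: "distinct [u, v, w, z]"
    and pre_ne: "pre e \<noteq> 1"
begin

abbreviation "k \<equiv> pre e"

definition ready :: "('e \<Rightarrow> nat) \<Rightarrow> bool" where
  "ready c \<longleftrightarrow> minimal c \<and> c gu = k \<and> c gv = k \<and> free c w 1"

lemma k_range: "2 \<le> k" "k \<le> \<Delta> + \<mu>" "k \<noteq> 0" "1 \<le> \<Delta> + \<mu>"
  using pre_range[OF eM] pre_ne by auto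

lemma eE: "e \<in> edges G" using eM M_edges by auto

lemma edges_distinct: "e \<noteq> gu" "e \<noteq> gv" "gu \<noteq> gv"
  using ends_e gu(2) gv(2) dist by (auto simp: doubleton_eq_iff)

lemma in_ball: "u \<in> ball n e" "v \<in> ball n e" "0 < n \<Longrightarrow> w \<in> ball n e" "0 < n \<Longrightarrow> z \<in> ball n e"
proof -
  have uv: "u \<in> ball 0 e" "v \<in> ball 0 e" using ends_e by auto
  then show "u \<in> ball n e" "v \<in> ball n e" using ball_mono[of 0 n e] by auto
  show "w \<in> ball n e" if "0 < n" using ball_step[OF gu uv(1) that] .
  show "z \<in> ball n e" if "0 < n" using ball_step[OF gv uv(2) that] .
qed

lemma ends_in_ball: "ends G e \<subseteq> ball 3 e" "ends G gu \<subseteq> ball 3 e" "ends G gv \<subseteq> ball 3 e"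
  using in_ball[of 3] ends_e gu gv by simp_all

lemma M_edge_near: "f \<in> M \<Longrightarrow> y \<in> ends G f \<Longrightarrow> y \<in> ball 4 e \<Longrightarrow> y \<in> {u, v}"
  using M_in_ball[OF eM, of f y 4] ends_e by auto

lemma readyD:
  assumes "ready c"
  shows "minimal c" "partial_colouring c" "zeros c = {}" "c e = 1" "c gu = k" "c gv = k" "free c w 1"
    "\<And>g. g \<in> edges G \<Longrightarrow> c g \<noteq> 0"
  using assms minimalD eM unfolding ready_def by auto

text \<open>Exchanging \<open>k\<close> and \<open>1\<close> along \<open>w\<close>,
  \<open>u\<close>, \<open>v\<close>, \<open>z\<close> works since neither \<open>w\<close> nor
  \<open>z\<close> sees colour \<open>1\<close>. The separate \<open>c0\<close> absorbs earlier
  changes within radius \<open>3\<close>.\<close>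

lemma prepared_finish:
  assumes "partial_colouring c" "zeros c = {}" "c e = 1" "c gu = k" "c gv = k" "free c w 1" "free c z 1"
    and "\<And>g. g \<in> edges G \<Longrightarrow> c g \<noteq> c0 g \<Longrightarrow> ends G g \<subseteq> ball 3 e"
  shows "prepared c0 e"
proof -
  define c1 where "c1 = c(e := 0, gu := 0, gv := 0)"
  define c2 where "c2 = c1(e := k)"
  define c3 where "c3 = c2(gu := 1)"
  define c4 where "c4 = c3(gv := 1)"
  note defs = c1_def c2_def c3_def c4_def
  have 1: "partial_colouring c1" unfolding c1_def by (intro partial_colouring_uncolour assms)
  have 2: "partial_colouring c2" unfolding c2_def
  proof (rule partial_colouring_colour[OF 1 ends_e])
    show "free c1 u k"
      by (rule free_recoloured[OF assms(1) gu(1) _ assms(4)])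
        (use gu k_range edges_distinct in \<open>auto simp: c1_def split: if_splits\<close>)
    show "free c1 v k"
      by (rule free_recoloured[OF assms(1) gv(1) _ assms(5)])
        (use gv k_range edges_distinct in \<open>auto simp: c1_def split: if_splits\<close>)
  qed (use k_range in auto)
  have u1: "free c2 u 1" and v1: "free c3 v 1"
    by (rule free_recoloured[OF assms(1) eE _ assms(3)];
        use ends_e gu dist k_range edges_distinct in \<open>auto simp: defs split: if_splits\<close>)+
  have 3: "partial_colouring c3" unfolding c3_def
  proof (rule partial_colouring_colour[OF 2 gu(2) u1])
    show "free c2 w 1"
      by (rule free_weaken[OF assms(6)]) (use k_range in \<open>auto simp: defs split: if_splits\<close>)
  qed (use k_range in auto)
  have 4: "partial_colouring c4" unfolding c4_def
  proof (rule partial_colouring_colour[OF 3 gv(2) v1])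
    show "free c3 z 1"
      by (rule free_weaken[OF assms(7)]) (use k_range gu dist in \<open>auto simp: defs split: if_splits\<close>)
  qed (use k_range in auto)
  have "zeros c4 = {}"
    using assms(2) k_range unfolding zeros_def defs by auto
  moreover have "c4 e = k" using edges_distinct unfolding defs by auto
  moreover have "ends G g \<subseteq> ball 3 e" if "g \<in> edges G" "c4 g \<noteq> c0 g" for g
    using that assms(8)[of g] ends_in_ball unfolding defs by (cases "g \<in> {e, gu, gv}") auto
  ultimately show ?thesis using 4 unfolding prepared_def by blast
qed

text \<open>Exchanging \<open>1\<close> and \<open>a\<close> on \<open>S\<close> removes colour
  \<open>1\<close> from \<open>z\<close> and leaves \<open>e\<close> and \<open>w\<close> alone.
  Also \<open>gu\<close> and \<open>gv\<close> keep \<open>k\<close>, because \<open>z\<close> sees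
  \<open>k\<close> but misses \<open>a\<close>.\<close>

lemma prepared_swap:
  assumes "ready c" "a \<in> miss c z" "sealed c a S {}" "S \<subseteq> ball 3 e" "u \<notin> S" "v \<notin> S" "w \<notin> S" "z \<in> S"
  shows "prepared c e"
proof -
  note r = readyD[OF assms(1)]
  have a: "2 \<le> a" "a \<le> \<Delta> + \<mu>" "free c z a" using assms(2) unfolding miss_def by auto
  have ak: "a \<noteq> k" using a(3) r(6) gv unfolding free_def by auto
  have cl: "kempe_closed c 1 a S" using sealed_kempe_closed[OF assms(3)] by auto
  let ?c = "kempe_swap S 1 a c"
  have "partial_colouring ?c" using partial_colouring_kempe_swap[OF r(2) cl] a k_range by auto
  moreover have "zeros ?c = {}" using zeros_kempe_swap[of 1 a] a r(3) by auto
  moreover have "?c e = 1" using r(4) ends_e assms(5,6) unfolding kempe_swap_def by auto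
  moreover have "?c gu = k" "?c gv = k" using r(5,6) ak pre_ne unfolding kempe_swap_def by auto
  moreover have "free ?c w 1" using free_kempe_swap(3)[OF cl] a assms(7) r(7) by auto
  moreover have "free ?c z 1" using free_kempe_swap(1)[OF cl _ assms(8)] a by auto
  moreover have "ends G g \<subseteq> ball 3 e" if "g \<in> edges G" "?c g \<noteq> c g" for g
    using that cl assms(4) unfolding kempe_swap_def kempe_closed_def by (auto split: if_splits)
  ultimately show ?thesis by (rule prepared_finish)
qed

text \<open>The condition on colour \<open>1\<close> will keep the new neighbour of \<open>z\<close>
  in a twin colouring outside \<open>S\<close>.\<close>

definition local_covered :: "('e \<Rightarrow> nat) \<Rightarrow> 'v set \<Rightarrow> bool" where
  "local_covered c S \<longleftrightarrow> z \<in> S \<and> S \<subseteq> ball 3 e \<and> u \<notin> S \<and> v \<notin> S \<and> (\<forall>y \<in> S. y \<noteq> w \<longrightarrow> \<not> free c y 1)"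

text \<open>The ways in which the \<open>(1, a)\<close>-chain from \<open>z\<close> can get stuck: it ends in \<open>w\<close>, or it reaches
  the end \<open>x\<close> of \<open>e\<close>.\<close>

definition chain_to_w :: "('e \<Rightarrow> nat) \<Rightarrow> nat \<Rightarrow> 'v set \<Rightarrow> bool" where
  "chain_to_w c a S \<longleftrightarrow> local_covered c S \<and> w \<in> S \<and> sealed c a S {}"

definition chain_to :: "('e \<Rightarrow> nat) \<Rightarrow> nat \<Rightarrow> 'v set \<Rightarrow> 'v \<Rightarrow> bool" where
  "chain_to c a S x \<longleftrightarrow> local_covered c S \<and> w \<notin> S \<and>
     (\<exists>d \<in> edges G. \<exists>r \<in> S. c d = a \<and> ends G d = {r, x} \<and> sealed c a S {d})"

text \<open>\<open>W\<close> is an initial piece of the chain, left through the edge \<open>f\<close> of colour \<open>1\<close> from \<open>x\<close> to \<open>r\<close>. The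
  cardinalities ensure that exchanging the colours on \<open>W\<close> preserves the number of \<open>1\<close>-edges.\<close>

definition chain_prefix :: "('e \<Rightarrow> nat) \<Rightarrow> nat \<Rightarrow> 'v set \<Rightarrow> 'e \<Rightarrow> 'v \<Rightarrow> 'v \<Rightarrow> bool" where
  "chain_prefix c a W f x r \<longleftrightarrow> f \<in> edges G \<and> ends G f = {x, r} \<and> c f = 1 \<and> x \<in> W \<and> r \<notin> W \<and>
     r \<notin> {u, v, w} \<and> r \<in> ball 2 e \<and> local_covered c W \<and> w \<notin> W \<and> sealed c a W {f} \<and>
     card {g \<in> edges G. c g = 1 \<and> ends G g \<subseteq> W} = card {g \<in> edges G. c g = a \<and> ends G g \<subseteq> W}"


text \<open>Uncolour \<open>f'\<close> and exchange on the longer piece: this frees \<open>z\<close>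
  of colour \<open>1\<close> and lowers the number of \<open>1\<close>-edges by one, so the fan of
  the hole has a vertex \<open>y \<noteq> z\<close> that does not see \<open>1\<close>. If
  \<open>y\<close> is not \<open>w\<close>, filling the hole there leaves both \<open>z\<close> and
  \<open>w\<close> without colour \<open>1\<close>. If \<open>y = w\<close>, then \<open>r'\<close>
  is a neighbour of \<open>w\<close>, and the chain is still near \<open>e\<close>.\<close>

lemma chain_extend:
  assumes rd: "ready c" and a: "a \<in> miss c z" and pf: "chain_prefix c a W f x r"
    and d: "d \<in> edges G" "ends G d = {r, x'}" "c d = a"
    and x': "x' \<notin> {u, v, w}"
    and f': "f' \<in> edges G" "ends G f' = {x', r'}" "c f' = 1"
  shows "success c e \<or> chain_prefix c a (insert x' (insert r W)) f' x' r'"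
proof -
  note R = readyD[OF rd]
  have a2: "2 \<le> a" "a \<le> \<Delta> + \<mu>" "free c z a" using a unfolding miss_def by auto
  have ak: "a \<noteq> k" using a2(3) R(6) gv unfolding free_def by auto
  have F: "f \<in> edges G" "ends G f = {x, r}" "c f = 1" "x \<in> W" "r \<notin> W" "r \<notin> {u, v, w}"
    "r \<in> ball 2 e" "w \<notin> W" "sealed c a W {f}"
    "card {g \<in> edges G. c g = 1 \<and> ends G g \<subseteq> W} = card {g \<in> edges G. c g = a \<and> ends G g \<subseteq> W}"
    and B: "z \<in> W" "W \<subseteq> ball 3 e" "u \<notin> W" "v \<notin> W" "\<And>y. y \<in> W \<Longrightarrow> y \<noteq> w \<Longrightarrow> \<not> free c y 1"
    using pf unfolding chain_prefix_def local_covered_def by auto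
  have uq: "g = h" if "g \<in> edges G" "h \<in> edges G" "y \<in> ends G g" "y \<in> ends G h" "c g = c h" for g h y
    using partial_colouring_unique[OF R(2) that] R(8) that(1) by blast
  have df: "d \<noteq> f" using d F a2 by auto
  have x'W: "x' \<notin> W"
    using sealedD[OF F(9) d(1), of x'] df d F(5) by auto
  have x'r: "x' \<noteq> r" using ends_neq[OF d(1,2)] by simp
  have r'x': "r' \<noteq> x'" using ends_neq[OF f'(1,2)] by simp
  have ff': "f' \<noteq> f"
  proof
    assume "f' = f"
    then have "x' \<in> {x, r}" using f' F by auto
    then show False using F(4) x'W x'r by auto
  qed
  define W' where "W' = insert x' (insert r W)"
  have r'W: "r' \<notin> W'"
  proof
    assume "r' \<in> W'"
    then consider "r' = x'" | "r' = r" | "r' \<in> W" unfolding W'_def by auto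
    then show False
    proof cases
      case 2
      then have "f' = f" using uq[of f' f r] f' F by auto
      then show False using ff' by simp
    next
      case 3
      then show False using sealedD[OF F(9) f'(1), of r'] ff' f' x'W by auto
    qed (use r'x' in simp)
  qed
  \<comment> \<open>Vertex \<open>w\<close> does not see \<open>1\<close>, and the
    \<open>1\<close>-edge at \<open>u\<close> and \<open>v\<close> is \<open>e\<close>.\<close>
  have r'uv: "r' \<notin> {u, v, w}"
  proof
    assume "r' \<in> {u, v, w}"
    moreover have "r' \<noteq> w" using R(7) f' unfolding free_def by auto
    ultimately have "f' = e" using uq[of f' e r'] f' ends_e eE R(4) by auto
    then show False using f'(2) ends_e x' by (auto simp: doubleton_eq_iff)
  qed
  have x'b: "x' \<in> ball 3 e" using ball_step[OF d(1,2) F(7), of 3] by simp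
  have W'b: "W' \<subseteq> ball 3 e"
    using B(2) x'b F(7) ball_mono[of 2 3 e] unfolding W'_def by auto
  have seal': "sealed c a W' {f'}"
    unfolding sealed_def
  proof (intro ballI impI)
    fix g assume g: "g \<in> edges G - {f'}" "c g \<in> {1, a}" "ends G g \<inter> W' \<noteq> {}"
    then obtain y where y: "y \<in> ends G g" "y \<in> W'" by blast
    consider "y \<in> W" "g \<noteq> f" | "g = f" | "y = r" "g \<noteq> f" | "y = x'" using y(2) unfolding W'_def by blast
    then show "ends G g \<subseteq> W'"
    proof cases
      case 1
      then show ?thesis using sealedD[OF F(9), of g y] g y unfolding W'_def by auto
    next
      case 2
      then show ?thesis using F unfolding W'_def by auto
    next
      case 3
      then have "c g \<noteq> 1" using uq[of g f r] y g F by auto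
      then have "g = d" using uq[of g d r] y g d 3 by auto
      then show ?thesis using d unfolding W'_def by auto
    next
      case 4
      then have "c g \<noteq> 1" using uq[of g f' x'] y g f' by auto
      then have "g = d" using uq[of g d x'] y g d 4 by auto
      then show ?thesis using d unfolding W'_def by auto
    qed
  qed
  have only1: "g \<in> insert f {g \<in> edges G. c g = 1 \<and> ends G g \<subseteq> W}"
    if "g \<in> edges G" "c g = 1" "ends G g \<subseteq> W'" for g
  proof (cases "r \<in> ends G g \<or> x' \<in> ends G g")
    case True
    then have "g = f \<or> g = f'" using uq[of g f r] uq[of g f' x'] that F f' by auto
    moreover have "g \<noteq> f'" using that(3) f'(2) r'W by auto
    ultimately show ?thesis by simp
  next
    case False
    then show ?thesis using that unfolding W'_def by auto
  qed
  have onlya: "g \<in> insert d {g \<in> edges G. c g = a \<and> ends G g \<subseteq> W}"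
    if "g \<in> edges G" "c g = a" "ends G g \<subseteq> W'" for g
  proof (cases "r \<in> ends G g \<or> x' \<in> ends G g")
    case True
    then have "g = d" using uq[of g d r] uq[of g d x'] that d by auto
    then show ?thesis by simp
  next
    case False
    then show ?thesis using that unfolding W'_def by auto
  qed
  let ?A1 = "{g \<in> edges G. c g = 1 \<and> ends G g \<subseteq> W'}" and ?Aa = "{g \<in> edges G. c g = a \<and> ends G g \<subseteq> W'}"
  \<comment> \<open>The extension adds one inner edge of each colour, \<open>f\<close> and
    \<open>d\<close>.\<close>
  have cnt: "card ?A1 = card ?Aa"
  proof -
    have "?A1 = insert f {g \<in> edges G. c g = 1 \<and> ends G g \<subseteq> W}"
      using only1 F unfolding W'_def by auto
    moreover have "f \<notin> {g \<in> edges G. c g = 1 \<and> ends G g \<subseteq> W}" using F by auto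
    moreover have "?Aa = insert d {g \<in> edges G. c g = a \<and> ends G g \<subseteq> W}"
      using onlya d unfolding W'_def by auto
    moreover have "d \<notin> {g \<in> edges G. c g = a \<and> ends G g \<subseteq> W}" using d F by auto
    ultimately show ?thesis using F(10) finite_edges by simp
  qed
  have base': "local_covered c W'"
  proof -
    have "\<not> free c x' 1" using f' unfolding free_def by auto
    moreover have "\<not> free c r 1" using F unfolding free_def by auto
    ultimately show ?thesis using B W'b x' F(6) unfolding local_covered_def W'_def by auto
  qed
  have wW': "w \<notin> W'" using F x' unfolding W'_def by auto
  define c0 where "c0 = c(f' := 0)"
  \<comment> \<open>Once \<open>f'\<close> is uncoloured, no edge of colour \<open>1\<close> or
    \<open>a\<close> leaves \<open>W'\<close>.\<close>
  have cl: "kempe_closed c0 1 a W'"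
    by (rule sealed_kempe_closed[OF seal']) (use a2 in \<open>auto simp: c0_def split: if_splits\<close>)
  define c' where "c' = kempe_swap W' 1 a c0"
  have a1: "1 \<noteq> a" using a2 by auto
  have p0: "partial_colouring c0" unfolding c0_def using R(2) by (rule partial_colouring_uncolour)
  have p': "partial_colouring c'" unfolding c'_def using partial_colouring_kempe_swap[OF p0 cl] a2 k_range by auto
  have z': "zeros c' = {f'}"
    unfolding c'_def using zeros_kempe_swap[of 1 a W' c0] a2 R(3) f' unfolding c0_def zeros_def by auto
  have M': "M \<subseteq> ones c'"
  proof
    fix m assume m: "m \<in> M"
    then have mE: "m \<in> edges G" "c m = 1" using M_edges minimalD(4)[OF R(1)] by auto
    have "y \<notin> W'" if "y \<in> ends G m" for y
      using M_edge_near[OF m that] W'b ball_mono[of 3 4 e] base' unfolding local_covered_def by auto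
    then have "ends G m \<inter> W' = {}" by blast
    moreover have "m \<noteq> f'" using \<open>ends G m \<inter> W' = {}\<close> f'(2) unfolding W'_def by auto
    ultimately show "m \<in> ones c'" using mE unfolding ones_def c'_def kempe_swap_def c0_def by simp
  qed
  have o': "ones c' = (ones c - {f'} - ?A1) \<union> ?Aa"
  proof (intro equalityI subsetI)
    fix g assume g: "g \<in> ones c'"
    then have gE: "g \<in> edges G" "c' g = 1" unfolding ones_def by auto
    then have gf': "g \<noteq> f'" using z' unfolding zeros_def by auto
    show "g \<in> (ones c - {f'} - ?A1) \<union> ?Aa"
    proof (cases "ends G g \<inter> W' = {}")
      case True
      moreover have "ends G g \<noteq> {}" using card_ends[OF gE(1)] by auto
      ultimately show ?thesis using gE gf' unfolding c'_def kempe_swap_def c0_def ones_def by auto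
    next
      case False
      have "c g = a"
      proof (rule ccontr)
        assume "c g \<noteq> a"
        then show False using gE(2) gf' False a1 unfolding c'_def kempe_swap_def c0_def by (simp split: if_splits)
      qed
      then show ?thesis using seal' gf' False gE unfolding sealed_def by auto
    qed
  next
    fix g assume "g \<in> (ones c - {f'} - ?A1) \<union> ?Aa"
    then show "g \<in> ones c'"
    proof
      assume g: "g \<in> ones c - {f'} - ?A1"
      then have "ends G g \<inter> W' = {}" using seal' unfolding sealed_def ones_def by blast
      then show ?thesis using g unfolding ones_def c'_def kempe_swap_def c0_def by auto
    next
      assume g: "g \<in> ?Aa"
      then have "g \<noteq> f'" using f' a1 by auto
      moreover have "ends G g \<noteq> {}" "ends G g \<subseteq> W'" using g card_ends[of g] by force+
      then have "ends G g \<inter> W' \<noteq> {}" by blast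
      ultimately show ?thesis using g a1 unfolding ones_def c'_def kempe_swap_def c0_def by simp
    qed
  qed
  have n': "Suc (card (ones c')) = card (ones c)"
  proof -
    have f'o: "f' \<in> ones c" using f' unfolding ones_def by auto
    have A1o: "?A1 \<subseteq> ones c - {f'}" using f'(2) r'W unfolding ones_def by auto
    have fin: "finite (ones c - {f'} - ?A1)" "finite ?Aa" using finite_ones finite_edges by auto
    have "(ones c - {f'} - ?A1) \<inter> ?Aa = {}" using a1 unfolding ones_def by auto
    then have "card (ones c') = card (ones c - {f'} - ?A1) + card ?Aa"
      unfolding o' using card_Un_disjoint[OF fin] by simp
    moreover have "card (ones c - {f'} - ?A1) = card (ones c - {f'}) - card ?A1"
      using A1o finite_ones by (intro card_Diff_subset) (auto intro: finite_subset)
    moreover have "card ?A1 \<le> card (ones c - {f'})" using A1o finite_ones by (intro card_mono) auto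
    moreover have "Suc (card (ones c - {f'})) = card (ones c)"
      using f'o finite_ones by (intro card_Suc_Diff1)
    ultimately show ?thesis using cnt by linarith
  qed
  have irr: "irreducible c'" using minimal_hole_irreducible[OF R(1) z' M'] n' by simp
  have hole: "c' f' = 0" using z' unfolding zeros_def by auto
  \<comment> \<open>\<open>z\<close> is excluded because a new edge of colour \<open>1\<close> there
    would undo the gain.\<close>
  obtain y where y: "(fan_step c' r')\<^sup>*\<^sup>* x' y" "free c' y 1" "y \<noteq> z"
    by (rule fan_free_avoiding[OF p' irr f'(1) hole f'(2), where s = z])
  show ?thesis
  proof (cases "y = w")
    case True
    then obtain h where h: "h \<in> edges G" "ends G h = {w, r'}"
      using fan_reach_verts[OF y(1) f'(1,2)] by (auto simp: insert_commute)
    have "r' \<in> ball 2 e" using ball_step[OF h in_ball(3)[of 1], of 2] by simp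
    then have "chain_prefix c a W' f' x' r'"
      using f' r'W r'uv base' wW' seal' cnt unfolding chain_prefix_def W'_def by simp
    then show ?thesis unfolding W'_def by blast
  next
    case yw: False
    have "free c0 r' 1" using free_uncolour[OF R(2) f'(1), of r'] f' unfolding c0_def by auto
    then have fr': "free c' r' 1" unfolding c'_def using free_kempe_swap(3)[OF cl a1 r'W] by blast
    show ?thesis
    proof (rule hole_fill[OF R(1) p' z' M' n' f'(2) fr' y(1,2), where H = "{}"])
      fix g c1 assume g: "g \<in> edges G" "ends G g = {r', y}" "minimal c1" "ones c1 = insert g (ones c')"
        and away: "\<And>h. r' \<notin> ends G h \<Longrightarrow> c1 h = c' h"
      have r'z: "r' \<noteq> z" using r'W B(1) unfolding W'_def by auto
      have keep: "c1 h = k" if "h \<in> {gu, gv}" for h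
      proof -
        have "r' \<notin> ends G h" using that r'uv r'z gu gv by auto
        moreover have "c h = k" "h \<noteq> f'" using that R f' pre_ne by auto
        ultimately show ?thesis using away ak pre_ne unfolding c'_def kempe_swap_def c0_def by auto
      qed
      have "free c0 z a" unfolding c0_def using a2 by (intro free_upd) auto
      then have "free c' z 1"
        unfolding c'_def using free_kempe_swap(1)[OF cl a1, of z] B(1) unfolding W'_def by blast
      then have fz: "free c1 z 1"
        by (rule free_weaken) (use g y r'z in \<open>auto simp: ones_def set_eq_iff\<close>)
      have "free c0 w 1" unfolding c0_def using R(7) by (intro free_upd) auto
      then have "free c' w 1" unfolding c'_def using free_kempe_swap(3)[OF cl a1 wW'] by blast
      then have fw: "free c1 w 1"
        by (rule free_weaken) (use g yw r'uv in \<open>auto simp: ones_def set_eq_iff\<close>)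
      have "prepared c1 e"
        using minimalD[OF g(3)] eM keep fz fw by (intro prepared_finish[of c1]) auto
      moreover have "ends G h \<subseteq> ball 5 e" if h: "h \<in> edges G" "c1 h \<noteq> c h" for h
      proof (cases "r' \<in> ends G h")
        case True
        \<comment> \<open>The origin of radius \<open>5\<close>: \<open>x'\<close> is within
          \<open>3\<close>, \<open>r'\<close> within \<open>4\<close>, and the shift recolours edges
          at \<open>r'\<close>.\<close>
        have "r' \<in> ball 4 e" using ball_step[OF f'(1,2) x'b, of 4] by simp
        then show ?thesis using ball_edge[OF h(1) True, of 4 e 5] by simp
      next
        case False
        then have "c' h \<noteq> c h" using away h by auto
        then have "ends G h \<inter> W' \<noteq> {}"
          using f'(2) unfolding c'_def kempe_swap_def c0_def W'_def by (auto split: if_splits)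
        then obtain s where "s \<in> ends G h" "s \<in> ball 3 e" using W'b by blast
        then show ?thesis using ball_edge[OF h(1), of s 3 e 5] by simp
      qed
      ultimately show ?thesis using g(3) unfolding success_def by blast
    qed simp
  qed
qed

text \<open>Follow the chain beyond \<open>r\<close> by an edge \<open>d\<close> of colour
  \<open>a\<close>. If there is none, or if \<open>d\<close> ends in a vertex other than
  \<open>w\<close> that does not see \<open>1\<close>, the chain is closed and
  \<open>prepared_swap\<close> applies. Ends in \<open>u\<close>, \<open>v\<close> or
  \<open>w\<close> are the ways of getting stuck; otherwise \<open>chain_extend\<close> goes
  on.\<close>

lemma chain_step:
  assumes rd: "ready c" and a: "a \<in> miss c z" and pf: "chain_prefix c a W f x r"
  shows "success c e \<or> (\<exists>S. chain_to_w c a S \<or> chain_to c a S u \<or> chain_to c a S v) \<or>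
    (\<exists>W' f' x' r'. chain_prefix c a W' f' x' r' \<and> W \<subset> W')"
proof -
  note R = readyD[OF rd]
  have F: "f \<in> edges G" "ends G f = {x, r}" "c f = 1" "x \<in> W" "r \<notin> W" "r \<notin> {u, v, w}"
    "r \<in> ball 2 e" "w \<notin> W" "sealed c a W {f}"
    and B: "z \<in> W" "W \<subseteq> ball 3 e" "u \<notin> W" "v \<notin> W" "\<And>y. y \<in> W \<Longrightarrow> y \<noteq> w \<Longrightarrow> \<not> free c y 1"
    using pf unfolding chain_prefix_def local_covered_def by auto
  have uq: "g = h" if "g \<in> edges G" "h \<in> edges G" "y \<in> ends G g" "y \<in> ends G h" "c g = c h" for g h y
    using partial_colouring_unique[OF R(2) that] R(8) that(1) by blast
  have rb: "insert r W \<subseteq> ball 3 e" using B(2) F(7) ball_mono[of 2 3 e] by auto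
  have "\<not> free c r 1" using F(1-3) unfolding free_def by auto
  then have base1: "local_covered c (insert r W)" using rb B F(6) unfolding local_covered_def by auto
  \<comment> \<open>At \<open>r\<close> only colour \<open>a\<close> needs checking, since the
    \<open>1\<close>-edge there is \<open>f\<close>, whose other end is in \<open>W\<close>.\<close>
  have seal: "sealed c a (T \<union> insert r W) D"
    if T: "\<And>g y. g \<in> edges G \<Longrightarrow> y \<in> ends G g \<Longrightarrow> y \<in> T \<Longrightarrow> g \<notin> D \<Longrightarrow> c g \<in> {1, a} \<Longrightarrow> ends G g \<subseteq> T \<union> insert r W"
      and D: "\<And>g. g \<in> edges G \<Longrightarrow> r \<in> ends G g \<Longrightarrow> g \<notin> D \<Longrightarrow> c g = a \<Longrightarrow> ends G g \<subseteq> T \<union> insert r W" for T D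
    unfolding sealed_def
  proof (intro ballI impI)
    fix g assume g: "g \<in> edges G - D" "c g \<in> {1, a}" "ends G g \<inter> (T \<union> insert r W) \<noteq> {}"
    then obtain y where y: "y \<in> ends G g" "y \<in> T \<union> insert r W" by blast
    consider "y \<in> T" | "g = f" | "y \<in> W" "g \<noteq> f" | "y = r" "g \<noteq> f" using y(2) by blast
    then show "ends G g \<subseteq> T \<union> insert r W"
    proof cases
      case 1
      then show ?thesis using T[of g y] g y by auto
    next
      case 2
      then show ?thesis using F by auto
    next
      case 3
      then show ?thesis using sealedD[OF F(9), of g y] g y by auto
    next
      case 4
      then have "c g = a" using uq[of g f r] y g F by auto
      then show ?thesis using D[of g] g y 4 by auto
    qed
  qed
  show ?thesis
  proof (cases "free c r a")
    case True
    then have "sealed c a ({} \<union> insert r W) {}" using seal[of "{}" "{}"] unfolding free_def by auto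
    then have "prepared c e"
      using base1 F(6,8) unfolding local_covered_def by (intro prepared_swap[OF rd a, of "insert r W"]) auto
    then show ?thesis using prepared_success[OF R(1)] by blast
  next
    case False
    then obtain d where d0: "d \<in> edges G" "r \<in> ends G d" "c d = a" by (rule not_free_obtain)
    obtain x' where d: "ends G d = {r, x'}" using ends_cases[OF d0(1,2)] by metis
    have onlyd: "g = d" if "g \<in> edges G" "r \<in> ends G g \<or> x' \<in> ends G g" "c g = a" for g
      using that uq[of g d r] uq[of g d x'] d0 d by auto
    have x'b: "x' \<in> ball 3 e" using ball_step[OF d0(1) d F(7), of 3] by simp
    consider (uv) "x' \<in> {u, v}" | (free) "x' \<notin> {u, v}" "free c x' 1" | (cov) "x' \<notin> {u, v, w}" "\<not> free c x' 1"
      using R(7) by blast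
    then show ?thesis
    proof cases
      case uv
      have "sealed c a ({} \<union> insert r W) {d}" using seal[of "{}" "{d}"] onlyd by auto
      then have "chain_to c a (insert r W) x'"
        unfolding chain_to_def using base1 F(6,8) d d0 by auto
      then show ?thesis using uv by auto
    next
      case free
      have "sealed c a ({x'} \<union> insert r W) {}"
      proof (rule seal)
        fix g y assume g: "g \<in> edges G" "y \<in> ends G g" "y \<in> {x'}" "c g \<in> {1, a}"
        then have "c g = a" using free(2) unfolding free_def by auto
        then have "g = d" using onlyd g by auto
        then show "ends G g \<subseteq> {x'} \<union> insert r W" using d by auto
      next
        fix g assume g: "g \<in> edges G" "r \<in> ends G g" "c g = a"
        then have "g = d" using onlyd by auto
        then show "ends G g \<subseteq> {x'} \<union> insert r W" using d by auto
      qed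
      then have sl: "sealed c a (insert x' (insert r W)) {}" by (simp add: insert_commute)
      show ?thesis
      proof (cases "x' = w")
        case True
        have "local_covered c (insert x' (insert r W))"
          using base1 x'b free(1) True unfolding local_covered_def by auto
        then have "chain_to_w c a (insert x' (insert r W))"
          unfolding chain_to_w_def using sl True by auto
        then show ?thesis by blast
      next
        case False
        then have "prepared c e"
          using base1 x'b free(1) F(6,8) unfolding local_covered_def by (intro prepared_swap[OF rd a sl]) auto
        then show ?thesis using prepared_success[OF R(1)] by blast
      qed
    next
      case cov
      obtain f' where f'0: "f' \<in> edges G" "x' \<in> ends G f'" "c f' = 1"
        using cov(2) by (rule not_free_obtain)
      obtain r' where f': "ends G f' = {x', r'}" using ends_cases[OF f'0(1,2)] by metis
      from chain_extend[OF rd a pf d0(1) d d0(3) cov(1) f'0(1) f' f'0(3)] F(5)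
      show ?thesis by blast
    qed
  qed
qed

text \<open>Take a prefix with as many vertices as possible. One exists: since \<open>z\<close>
  misses \<open>a\<close>, the set \<open>{z}\<close> is left only through \<open>f\<close>.\<close>

lemma chain:
  assumes rd: "ready c" and a: "a \<in> miss c z" and f: "f \<in> edges G" "ends G f = {z, q}" "c f = 1"
  shows "success c e \<or> (\<exists>S. chain_to_w c a S \<or> chain_to c a S u \<or> chain_to c a S v)"
proof -
  note R = readyD[OF rd]
  have a2: "2 \<le> a" "free c z a" using a unfolding miss_def by auto
  have uq: "g = h" if "g \<in> edges G" "h \<in> edges G" "y \<in> ends G g" "y \<in> ends G h" "c g = c h" for g h y
    using partial_colouring_unique[OF R(2) that] R(8) that(1) by blast
  have qw: "q \<noteq> w" using R(7) f unfolding free_def by auto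
  have quv: "q \<notin> {u, v}"
  proof
    assume "q \<in> {u, v}"
    then have "f = e" using uq[of f e q] f ends_e eE R(4) by auto
    then show False using f ends_e dist by (auto simp: doubleton_eq_iff)
  qed
  have zb: "z \<in> ball 1 e" "z \<in> ball 3 e" by (intro in_ball(4); simp)+
  have qb: "q \<in> ball 2 e" using ball_step[OF f(1,2) zb(1), of 2] by simp
  have nosub: "\<not> ends G g \<subseteq> {z}" if "g \<in> edges G" for g
    using card_ends[OF that] by (auto dest: card_mono[rotated])
  have sl: "sealed c a {z} {f}"
    unfolding sealed_def
  proof (intro ballI impI)
    fix g assume g: "g \<in> edges G - {f}" "c g \<in> {1, a}" "ends G g \<inter> {z} \<noteq> {}"
    then have "z \<in> ends G g" by auto
    then have "c g \<noteq> a" "c g \<noteq> 1" using a2 g uq[of g f z] f unfolding free_def by auto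
    with g show "ends G g \<subseteq> {z}" by auto
  qed
  have "{g \<in> edges G. c g = b \<and> ends G g \<subseteq> {z}} = {}" for b using nosub by auto
  then have "card {g \<in> edges G. c g = 1 \<and> ends G g \<subseteq> {z}} = card {g \<in> edges G. c g = a \<and> ends G g \<subseteq> {z}}"
    by (simp only: card.empty)
  moreover have "\<not> free c z 1" using f unfolding free_def by auto
  ultimately have "chain_prefix c a {z} f z q"
    using f qw quv qb zb(2) sl dist ends_neq[OF f(1,2)] unfolding chain_prefix_def local_covered_def by simp
  then have ex: "(\<lambda>W. \<exists>f x r. chain_prefix c a W f x r) {z}" by blast
  have bound: "\<forall>W. (\<exists>f x r. chain_prefix c a W f x r) \<longrightarrow> card W < Suc (card (verts G))"
  proof (intro allI impI)
    fix W assume "\<exists>f x r. chain_prefix c a W f x r"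
    then have "W \<subseteq> verts G" using ball_verts[OF eE, of 3] unfolding chain_prefix_def local_covered_def by blast
    then show "card W < Suc (card (verts G))"
      using card_mono[OF finite_verts] by (simp add: less_Suc_eq_le)
  qed
  have "\<exists>W. (\<exists>f x r. chain_prefix c a W f x r) \<and> (\<forall>W'. (\<exists>f x r. chain_prefix c a W' f x r) \<longrightarrow> card W' \<le> card W)"
    by (rule ex_has_greatest_nat[OF ex bound])
  then obtain W f1 x r where W: "chain_prefix c a W f1 x r"
    and Wmax: "\<And>W' f x r. chain_prefix c a W' f x r \<Longrightarrow> card W' \<le> card W" by blast
  have False if "chain_prefix c a W' f' x' r'" "W \<subset> W'" for W' f' x' r'
  proof -
    have "W' \<subseteq> verts G" using that(1) ball_verts[OF eE, of 3] unfolding chain_prefix_def local_covered_def by blast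
    then have "finite W'" using finite_verts by (rule finite_subset)
    then show False using psubset_card_mono[OF _ that(2)] Wmax[OF that(1)] by simp
  qed
  then show ?thesis using chain_step[OF rd a W] by blast
qed


section \<open>Comparing the chains of two colourings\<close>

text \<open>Two colourings that differ by moving the edge of colour \<open>1\<close> at \<open>z\<close>.\<close>

definition twin :: "nat \<Rightarrow> ('e \<Rightarrow> nat) \<Rightarrow> 'e \<Rightarrow> ('e \<Rightarrow> nat) \<Rightarrow> 'e \<Rightarrow> bool" where
  "twin a c f c' f' \<longleftrightarrow> ready c \<and> ready c' \<and> a \<in> miss c z \<and> a \<in> miss c' z \<and>
     (\<forall>g \<in> edges G. c g = a \<longleftrightarrow> c' g = a) \<and>
     f \<in> ones c \<and> f' \<in> ones c' \<and> ones c - {f} = ones c' - {f'} \<and>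
     (\<exists>q. ends G f = {z, q} \<and> q \<noteq> w \<and> free c' q 1) \<and>
     (\<exists>t. ends G f' = {z, t} \<and> t \<noteq> w \<and> free c t 1)"

lemma twin_sym: "twin a c f c' f' \<Longrightarrow> twin a c' f' c f"
  unfolding twin_def by auto

text \<open>In \<open>c'\<close> the only edge of colour \<open>1\<close> or \<open>a\<close> at
  \<open>z\<close> is \<open>f'\<close>, whose other end does not see \<open>1\<close> in
  \<open>c\<close> and hence lies outside \<open>S\<close>. On edges avoiding \<open>z\<close> the
  two colourings have the same classes of \<open>1\<close> and \<open>a\<close>.\<close>

lemma twin_sealed:
  assumes tw: "twin a c f c' f'" and S: "local_covered c S" "sealed c a S D"
  shows "sealed c' a (S - {z}) D"
  unfolding sealed_def
proof (intro ballI impI)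
  fix g assume g: "g \<in> edges G - D" "c' g \<in> {1, a}" "ends G g \<inter> (S - {z}) \<noteq> {}"
  then obtain y where y: "y \<in> ends G g" "y \<in> S" "y \<noteq> z" by blast
  have T: "ready c" "a \<in> miss c z" "\<And>g. g \<in> edges G \<Longrightarrow> c g = a \<longleftrightarrow> c' g = a"
    "f \<in> ones c" "ones c - {f} = ones c' - {f'}" "z \<in> ends G f"
    using tw unfolding twin_def by auto
  obtain t where t: "ends G f' = {z, t}" "t \<noteq> w" "free c t 1" using tw unfolding twin_def by auto
  have zg: "z \<notin> ends G g" "c g \<in> {1, a}"
  proof -
    have "z \<notin> ends G g \<and> c g \<in> {1, a}"
    proof (cases "c' g = a")
      case True
      then have "c g = a" using T(3) g by auto
      then show ?thesis using T(2) g unfolding miss_def free_def by auto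
    next
      case False
      then have "c' g = 1" using g by auto
      have "g \<noteq> f'"
      proof
        assume "g = f'"
        then have "y = t" using y t by auto
        then show False using y(2) S(1) t unfolding local_covered_def by auto
      qed
      then have "g \<in> ones c - {f}" unfolding T(5) using \<open>c' g = 1\<close> g by (auto simp: ones_def)
      then have gf: "c g = 1" "g \<noteq> f" by (auto simp: ones_def)
      have "z \<notin> ends G g"
      proof
        assume "z \<in> ends G g"
        then have "g = f"
          using partial_colouring_unique[OF readyD(2)[OF T(1)], of g f z] gf(1) g(1) T(4,6) by (auto simp: ones_def)
        then show False using gf by simp
      qed
      then show ?thesis using gf by simp
    qed
    then show "z \<notin> ends G g" "c g \<in> {1, a}" by auto
  qed
  have "ends G g \<subseteq> S" using sealedD[OF S(2), of g y] g y zg by auto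
  then show "ends G g \<subseteq> S - {z}" using zg by auto
qed

text \<open>Exchange on \<open>S\<close>, recolour the exceptional edge \<open>d\<close> by \<open>1\<close>, and \<open>e\<close>, \<open>gu\<close>, \<open>gv\<close> by \<open>k\<close>, \<open>bu\<close>, \<open>bv\<close>.\<close>

lemma finish_exchange:
  assumes rd: "ready c" and a: "a \<in> miss c z"
    and d: "d \<in> edges G" "c d = a" "ends G d = {r, s}" "s \<in> {u, v}" "r \<in> S"
    and S: "S \<subseteq> ball 3 e" "u \<notin> S" "v \<notin> S" "sealed c a S {d}"
    and b: "bu \<in> {1, a}" "bv \<in> {1, a}" "if s = u then bu = a else bv = a" "if s = u then bv = 1 else bu = 1"
    and w: "if bu = 1 then w \<notin> S else w \<in> S" and z: "if bv = 1 then z \<in> S else z \<notin> S"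
  shows "prepared c e"
proof -
  note R = readyD[OF rd]
  have a2: "2 \<le> a" "a \<le> \<Delta> + \<mu>" "free c z a" using a unfolding miss_def by auto
  have ak: "a \<noteq> k" using a2(3) R(6) gv unfolding free_def by auto
  have dd: "d \<noteq> e" "d \<noteq> gu" "d \<noteq> gv" using d(2) R(4-6) a2 ak by auto
  note nn = dd dd[symmetric] edges_distinct edges_distinct[symmetric]
  define c1 where "c1 = c(e := 0, gu := 0, gv := 0, d := 0)"
  have p1: "partial_colouring c1" unfolding c1_def by (intro partial_colouring_uncolour R)
  have cl: "kempe_closed c1 1 a S"
    by (rule sealed_kempe_closed[OF S(4)]) (use a2 in \<open>auto simp: c1_def split: if_splits\<close>)
  have a1: "1 \<noteq> a" using a2 by auto
  define c2 where "c2 = kempe_swap S 1 a c1"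
  have p2: "partial_colouring c2" unfolding c2_def using partial_colouring_kempe_swap[OF p1 cl] a2 k_range by auto
  have out: "free c2 y b \<longleftrightarrow> free c1 y b" if "y \<notin> S" for y b
    unfolding c2_def using free_kempe_swap(3)[OF cl a1 that] .
  have u1: "free c1 u 1" and v1: "free c1 v 1"
    by (rule free_recoloured[OF R(2) eE _ R(4)];
        use ends_e nn in \<open>auto simp: c1_def split: if_splits\<close>)+
  have sa: "free c1 s a" and ra: "free c1 r a"
    by (rule free_recoloured[OF R(2) d(1) _ d(2)];
        use d a2 nn in \<open>auto simp: c1_def split: if_splits\<close>)+
  have uk: "free c1 u k"
    by (rule free_recoloured[OF R(2) gu(1) _ R(5)])
      (use gu k_range nn in \<open>auto simp: c1_def split: if_splits\<close>)
  have vk: "free c1 v k"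
    by (rule free_recoloured[OF R(2) gv(1) _ R(6)])
      (use gv k_range nn in \<open>auto simp: c1_def split: if_splits\<close>)
  have w1: "free c1 w 1"
    by (rule free_weaken[OF R(7)]) (auto simp: c1_def split: if_splits)
  have za: "free c1 z a"
    by (rule free_weaken[OF a2(3)]) (use a2 in \<open>auto simp: c1_def split: if_splits\<close>)
  \<comment> \<open>At \<open>s\<close> the colours \<open>1\<close>, \<open>k\<close>,
    \<open>a\<close> of \<open>e\<close>, the \<open>k\<close>-edge and \<open>d\<close> rotate; at
    the other end of \<open>e\<close> the colours \<open>1\<close> and \<open>k\<close> are
    exchanged. Whether \<open>w\<close> and \<open>z\<close> lie in \<open>S\<close> decides which
    colour they can accept.\<close>
  define c3 where "c3 = c2(e := k)"
  define c4 where "c4 = c3(gu := bu)"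
  define c5 where "c5 = c4(gv := bv)"
  define c6 where "c6 = c5(d := 1)"
  have D: "1 \<le> \<Delta> + \<mu>" "bu \<le> \<Delta> + \<mu>" "bv \<le> \<Delta> + \<mu>" using k_range a2 b by auto
  have kb: "k \<noteq> bu" "k \<noteq> bv" using b ak pre_ne by auto
  have p3: "partial_colouring c3" unfolding c3_def
    by (rule partial_colouring_colour[OF p2 ends_e]) (use uk vk out S k_range in auto)
  have ubu: "free c2 u bu" using out[OF S(2)] u1 sa b dist d(4) by (auto split: if_splits)
  have wbu: "free c2 w bu"
  proof (cases "bu = 1")
    case True
    then show ?thesis using w out[of w 1] w1 by auto
  next
    case False
    then have "bu = a" "w \<in> S" using b(1) w by auto
    then show ?thesis unfolding c2_def using free_kempe_swap(2)[OF cl a1] w1 by auto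
  qed
  have p4: "partial_colouring c4" unfolding c4_def
  proof (rule partial_colouring_colour[OF p3 gu(2) _ _ D(2)])
    show "free c3 u bu" unfolding c3_def using ubu kb by (intro free_upd) auto
    show "free c3 w bu" unfolding c3_def using wbu kb by (intro free_upd) auto
  qed
  have vbv: "free c2 v bv" using out[OF S(3)] v1 sa b dist d(4) by (auto split: if_splits)
  have zbv: "free c2 z bv"
  proof (cases "bv = 1")
    case True
    then show ?thesis unfolding c2_def using z free_kempe_swap(1)[OF cl a1] za by auto
  next
    case False
    then have "bv = a" "z \<notin> S" using b(2) z by auto
    then show ?thesis using out[of z a] za by auto
  qed
  have p5: "partial_colouring c5" unfolding c5_def
  proof (rule partial_colouring_colour[OF p4 gv(2) _ _ D(3)])
    show "free c4 v bv" unfolding c4_def c3_def using vbv kb gu dist by (intro free_upd) auto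
    show "free c4 z bv" unfolding c4_def c3_def using zbv kb gu dist by (intro free_upd) auto
  qed
  have r1: "free c2 r 1" unfolding c2_def using free_kempe_swap(1)[OF cl a1 d(5)] ra by auto
  have s1: "free c2 s 1" using out[of s 1] S d(4) u1 v1 by auto
  have rw: "r \<noteq> u" "r \<noteq> v" using d(5) S by auto
  \<comment> \<open>If \<open>gu\<close> or \<open>gv\<close> has received \<open>1\<close>, it must
    avoid both ends of \<open>d\<close>; for \<open>gv\<close> this rests on
    \<open>r \<noteq> z\<close>, true since \<open>z\<close> misses \<open>a\<close>.\<close>
  have fin1: "free c5 y 1" if "free c2 y 1" "y \<in> {r, s}" for y
  proof -
    have "free c4 y 1"
    proof (cases "bu = 1")
      case True
      then have "s = v" using b(3) a1 d(4) by (auto split: if_splits)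
      moreover have "r \<noteq> w" using w True d(5) by auto
      ultimately have "y \<notin> ends G gu" using that(2) rw gu(2) dist by auto
      then show ?thesis unfolding c4_def c3_def using that pre_ne by (intro free_upd) auto
    next
      case False
      then show ?thesis unfolding c4_def c3_def using that pre_ne by (intro free_upd) auto
    qed
    moreover have "y \<notin> ends G gv \<or> bv \<noteq> 1"
    proof (rule ccontr)
      assume "\<not> ?thesis"
      then have y: "y \<in> {v, z}" "bv = 1" using gv by auto
      then have "s = u" using b a1 by (auto split: if_splits)
      then have "y = r" "y = z" using y that(2) rw dist by auto
      then have "r = z" by simp
      then show False using d a2 unfolding free_def by auto
    qed
    ultimately show ?thesis unfolding c5_def by (intro free_upd) auto
  qed
  have p6: "partial_colouring c6" unfolding c6_def
    by (rule partial_colouring_colour[OF p5 d(3) fin1[OF r1] fin1[OF s1] D(1)]) auto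
  have "zeros c6 = {}"
  proof -
    have "c6 g \<noteq> 0" if "g \<in> edges G" for g
      using R(8)[OF that] b a2 k_range
      unfolding c6_def c5_def c4_def c3_def c2_def kempe_swap_def c1_def by auto
    then show ?thesis unfolding zeros_def by auto
  qed
  moreover have "c6 e = k" using nn unfolding c6_def c5_def c4_def c3_def by auto
  moreover have "ends G g \<subseteq> ball 3 e" if g: "g \<in> edges G" "c6 g \<noteq> c g" for g
  proof (cases "g \<in> {e, gu, gv, d}")
    case True
    then show ?thesis using ends_in_ball d(3,4,5) S(1) in_ball(1,2)[of 3] by auto
  next
    case False
    then have "c6 g = c2 g" "c1 g = c g" unfolding c6_def c5_def c4_def c3_def c1_def by auto
    then have "ends G g \<inter> S \<noteq> {} \<and> c1 g \<in> {1, a}"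
      using g unfolding c2_def kempe_swap_def by (auto split: if_splits)
    then have "ends G g \<subseteq> S" using cl g unfolding kempe_closed_def by auto
    then show ?thesis using S(1) by auto
  qed
  ultimately show ?thesis using p6 unfolding prepared_def by blast
qed

text \<open>For \<open>c'\<close> the set \<open>S - {z}\<close> contains neither \<open>z\<close>
  nor \<open>w\<close>, so \<open>gv\<close> can take \<open>a\<close> and \<open>gu\<close> can
  take \<open>1\<close>.\<close>

lemma twin_V:
  assumes tw: "twin a c f c' f'" and X: "chain_to c a S v"
  shows "prepared c' e"
proof -
  obtain d r where d: "d \<in> edges G" "r \<in> S" "c d = a" "ends G d = {r, v}" "sealed c a S {d}"
    and B: "local_covered c S" "w \<notin> S"
    using X unfolding chain_to_def by auto
  have T: "ready c'" "a \<in> miss c' z" "c' d = a" "a \<in> miss c z" using tw d unfolding twin_def by auto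
  have "r \<noteq> z" using T(4) d unfolding miss_def free_def by auto
  have vu: "v \<noteq> u" using dist by auto
  show ?thesis
  proof (rule finish_exchange[OF T(1,2) d(1) T(3) d(4), where S = "S - {z}" and bu = 1 and bv = a])
    show "S - {z} \<subseteq> ball 3 e" "u \<notin> S - {z}" "v \<notin> S - {z}" using B(1) unfolding local_covered_def by auto
    show "sealed c' a (S - {z}) {d}" using twin_sealed[OF tw B(1) d(5)] .
  qed (use vu d(2) B(2) T(2) \<open>r \<noteq> z\<close> in \<open>auto simp: miss_def\<close>)
qed

text \<open>The union of \<open>S - {z}\<close> and \<open>S'\<close> contains both \<open>w\<close>
  and \<open>z\<close> and is left only through the edge to \<open>u\<close>, so \<open>gu\<close>
  can take \<open>a\<close> and \<open>gv\<close> can take \<open>1\<close>.\<close>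

lemma twin_WU:
  assumes tw: "twin a c f c' f'" and W: "chain_to_w c a S" and X: "chain_to c' a S' u"
  shows "prepared c' e"
proof -
  have B: "local_covered c S" "w \<in> S" "sealed c a S {}" using W unfolding chain_to_w_def by auto
  obtain d r where d: "d \<in> edges G" "r \<in> S'" "c' d = a" "ends G d = {r, u}" "sealed c' a S' {d}"
    and B': "local_covered c' S'"
    using X unfolding chain_to_def by auto
  have T: "ready c'" "a \<in> miss c' z" using tw unfolding twin_def by auto
  have "sealed c' a (S - {z}) {}" using twin_sealed[OF tw B(1,3)] .
  then have sl: "sealed c' a ((S - {z}) \<union> S') {d}"
    using d(5) unfolding sealed_def by blast
  have w: "w \<in> (S - {z}) \<union> S'" "z \<in> (S - {z}) \<union> S'"
    using B B' dist unfolding local_covered_def by auto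
  show ?thesis
  proof (rule finish_exchange[OF T d(1,3,4), where S = "(S - {z}) \<union> S'" and bu = a and bv = 1])
    show "(S - {z}) \<union> S' \<subseteq> ball 3 e" "u \<notin> (S - {z}) \<union> S'" "v \<notin> (S - {z}) \<union> S'"
      using B(1) B' unfolding local_covered_def by auto
  qed (use d(2) sl w T(2) in \<open>auto simp: miss_def\<close>)
qed

text \<open>Removing \<open>S - {z}\<close> from \<open>S'\<close> leaves a closed set that contains
  \<open>z\<close> but not \<open>w\<close>.\<close>

lemma twin_WW:
  assumes tw: "twin a c f c' f'" and W: "chain_to_w c a S" "chain_to_w c' a S'"
  shows "prepared c' e"
proof -
  have B: "local_covered c S" "w \<in> S" "sealed c a S {}" "local_covered c' S'" "sealed c' a S' {}"
    using W unfolding chain_to_w_def by auto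
  have T: "ready c'" "a \<in> miss c' z" using tw unfolding twin_def by auto
  have s: "sealed c' a (S - {z}) {}" using twin_sealed[OF tw B(1,3)] .
  have "sealed c' a (S' - (S - {z})) {}"
    using s B(5) unfolding sealed_def by blast
  then show ?thesis
    using B(1,2,4) dist unfolding local_covered_def by (intro prepared_swap[OF T, of "S' - (S - {z})"]) auto
qed

text \<open>Both chains meet \<open>u\<close> through the same edge \<open>d\<close>, the only one
  of colour \<open>a\<close> there. Its other end lies in \<open>S - {z}\<close>, so
  \<open>S' - (S - {z})\<close> avoids \<open>d\<close> and is closed.\<close>

lemma twin_UU:
  assumes tw: "twin a c f c' f'" and X: "chain_to c a S u" "chain_to c' a S' u"
  shows "prepared c' e"
proof -
  obtain d r where d: "d \<in> edges G" "r \<in> S" "c d = a" "ends G d = {r, u}" "sealed c a S {d}"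
    and B: "local_covered c S"
    using X(1) unfolding chain_to_def by auto
  obtain d' where d': "d' \<in> edges G" "c' d' = a" "u \<in> ends G d'" "sealed c' a S' {d'}"
    and B': "local_covered c' S'" "w \<notin> S'"
    using X(2) unfolding chain_to_def by auto
  have T: "ready c'" "a \<in> miss c' z" "a \<in> miss c z" "c' d = a" using tw d unfolding twin_def by auto
  have "d' = d"
    using partial_colouring_unique[OF readyD(2)[OF T(1)], of d' d u] d d' T unfolding miss_def by auto
  have rz: "r \<noteq> z" using T(3) d unfolding miss_def free_def by auto
  have s: "sealed c' a (S - {z}) {d}" using twin_sealed[OF tw B d(5)] .
  have nd: "ends G d \<inter> (S' - (S - {z})) = {}"
    using d(2,4) rz B'(1) unfolding local_covered_def by auto
  have "sealed c' a (S' - (S - {z})) {}"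
    unfolding sealed_def
  proof (intro ballI impI)
    fix g assume g: "g \<in> edges G - {}" "c' g \<in> {1, a}" "ends G g \<inter> (S' - (S - {z})) \<noteq> {}"
    then obtain y where y: "y \<in> ends G g" "y \<in> S'" "y \<notin> S - {z}" by blast
    have "g \<noteq> d" using g(3) nd by auto
    then have "ends G g \<subseteq> S'" using sealedD[OF d'(4), of g y] g y \<open>d' = d\<close> by auto
    moreover have "y' \<notin> S - {z}" if "y' \<in> ends G g" for y'
      using sealedD[OF s, of g y'] g y that \<open>g \<noteq> d\<close> by auto
    ultimately show "ends G g \<subseteq> S' - (S - {z})" by blast
  qed
  then show ?thesis
    using B B' dist unfolding local_covered_def by (intro prepared_swap[OF T(1,2), of "S' - (S - {z})"]) auto
qed

text \<open>If \<open>z\<close> sees \<open>1\<close>, shifting its \<open>1\<close>-edge from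
  \<open>q\<close> to another neighbour \<open>t\<close> gives a twin colouring, and the two chains
  from \<open>z\<close> are compared. The cases where the shift hits \<open>gv\<close> or where
  \<open>t = w\<close> are solved directly.\<close>

lemma ready_success:
  assumes rd: "ready c"
  shows "success c e"
proof (cases "free c z 1")
  case True
  note R = readyD[OF rd]
  have "prepared c e" using R True by (intro prepared_finish[of c]) auto
  then show ?thesis using prepared_success R(1) by blast
next
  case False
  note R = readyD[OF rd]
  obtain f where f0: "f \<in> edges G" "z \<in> ends G f" "c f = 1" using False by (rule not_free_obtain)
  obtain q where f: "ends G f = {z, q}" using ends_cases[OF f0(1,2)] by metis
  have zq: "z \<noteq> q" using ends_neq[OF f0(1) f] .
  have uq: "g = h" if "g \<in> edges G" "h \<in> edges G" "y \<in> ends G g" "y \<in> ends G h" "c g = c h" for g h y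
    using partial_colouring_unique[OF R(2) that] R(8) that(1) by blast
  have qw: "q \<noteq> w" using R(7) f0 f unfolding free_def by auto
  have zV: "z \<in> verts G" using f0 ends_verts by auto
  have "card (miss c z) \<ge> 1" using card_miss_ge[OF R(2) zV] False multiplicity_pos[OF f0(1)] by simp
  then obtain a where a: "a \<in> miss c z" by fastforce
  have a2: "2 \<le> a" "free c z a" using a unfolding miss_def by auto
  have feM: "f \<notin> M"
  proof
    assume "f \<in> M"
    then have "z \<in> {u, v}" using M_edge_near f0(2) in_ball(4)[of 4] by auto
    then show False using dist by auto
  qed
  have fne: "f \<noteq> gu" "f \<noteq> gv" using f0(3) R pre_ne by auto
  define c' where "c' = c(f := 0)"
  have p': "partial_colouring c'" unfolding c'_def using R(2) by (rule partial_colouring_uncolour)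
  have z': "zeros c' = {f}" unfolding c'_def using R(3) f0 unfolding zeros_def by auto
  have o': "ones c' = ones c - {f}" unfolding c'_def ones_def by auto
  have M': "M \<subseteq> ones c'" unfolding o' using minimalD(3)[OF R(1)] feM by auto
  have fo: "f \<in> ones c" using f0 unfolding ones_def by auto
  have n': "Suc (card (ones c')) = card (ones c)"
    unfolding o' using fo finite_ones by (intro card_Suc_Diff1)
  have irr: "irreducible c'" using minimal_hole_irreducible[OF R(1) z' M'] n' by simp
  have fq: "ends G f = {q, z}" using f by auto
  have "c' f = 0" unfolding c'_def by simp
  then obtain t where t: "(fan_step c' z)\<^sup>*\<^sup>* q t" "free c' t 1" "t \<noteq> q"
    by (rule fan_free_avoiding[OF p' irr f0(1) _ fq, where s = q])
  have tz: "t \<noteq> z" using fan_reach_verts[OF t(1) f0(1) fq] ends_neq by metis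
  have ft: "free c t 1"
    using t(2,3) tz f unfolding c'_def free_def by (metis fun_upd_other insertE singletonD)
  have fz: "free c' z 1" unfolding c'_def using free_uncolour[OF R(2) f0(1,2)] f0 by auto
  have ballz: "ends G h \<subseteq> ball 3 e" if "h \<in> edges G" "z \<in> ends G h" for h
    using ball_edge[OF that in_ball(4)[of 1], of 3] by simp
  show ?thesis
  \<comment> \<open>The shift at \<open>z\<close> could recolour \<open>gv\<close>; with
    \<open>H = {gv}\<close> it stops there instead.\<close>
  proof (rule hole_fill[OF R(1) p' z' M' n' fq fz t(1,2), where H = "{gv}"])
    fix g p c1 assume g: "g \<in> {gv}" "ends G g = {z, p}" "partial_colouring c1" "zeros c1 = {g}" "ones c1 = ones c'"
      and away: "\<And>h. z \<notin> ends G h \<Longrightarrow> c1 h = c' h"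
      and lf: "\<And>a. a \<noteq> 0 \<Longrightarrow> free (c'(g := 0)) p a \<Longrightarrow> free c1 p a"
    have gg: "g = gv" "p = v" using g gv dist by (auto simp: doubleton_eq_iff)
    have c1e: "c1 e = 1" using g(5) M' eM eE unfolding ones_def by auto
    have c1u: "c1 gu = k" using away[of gu] gu dist fne R(5) unfolding c'_def by auto
    \<comment> \<open>With \<open>gv\<close> uncoloured, \<open>v\<close> has lost its
      \<open>k\<close>-edge: \<open>e\<close> can take \<open>k\<close>, and \<open>gu\<close> and
      \<open>gv\<close> can take \<open>1\<close>.\<close>
    have vk: "free c1 v k"
    proof -
      have "free (c'(g := 0)) v k"
        by (rule free_recoloured[OF R(2) gv(1) _ R(6)])
          (use gv k_range gg in \<open>auto simp: c'_def split: if_splits\<close>)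
      then show ?thesis using lf k_range gg by auto
    qed
    define d1 where "d1 = c1(e := 0, gu := 0)"
    define d2 where "d2 = d1(e := k)"
    define d3 where "d3 = d2(gu := 1)"
    define d4 where "d4 = d3(gv := 1)"
    note defs = d1_def d2_def d3_def d4_def
    have 1: "partial_colouring d1" unfolding d1_def by (intro partial_colouring_uncolour g)
    have 2: "partial_colouring d2" unfolding d2_def
    proof (rule partial_colouring_colour[OF 1 ends_e])
      show "free d1 u k"
        by (rule free_recoloured[OF g(3) gu(1) _ c1u])
          (use gu k_range edges_distinct in \<open>auto simp: d1_def split: if_splits\<close>)
      show "free d1 v k"
        by (rule free_weaken[OF vk]) (use k_range in \<open>auto simp: d1_def split: if_splits\<close>)
    qed (use k_range in auto)
    have u1: "free d2 u 1" and v1: "free d3 v 1"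
      by (rule free_recoloured[OF g(3) eE _ c1e];
          use ends_e gu dist k_range edges_distinct in \<open>auto simp: defs split: if_splits\<close>)+
    have "free c' w 1" by (rule free_weaken[OF R(7)]) (auto simp: c'_def split: if_splits)
    then have w1: "free c1 w 1" and z1: "free c1 z 1" using fz free_one_iff[OF g(5)] by auto
    have 3: "partial_colouring d3" unfolding d3_def
    proof (rule partial_colouring_colour[OF 2 gu(2) u1])
      show "free d2 w 1"
        by (rule free_weaken[OF w1]) (use k_range in \<open>auto simp: defs split: if_splits\<close>)
    qed (use k_range in auto)
    have 4: "partial_colouring d4" unfolding d4_def
    proof (rule partial_colouring_colour[OF 3 gv(2) v1])
      show "free d3 z 1"
        by (rule free_weaken[OF z1]) (use k_range gu dist in \<open>auto simp: defs split: if_splits\<close>)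
    qed (use k_range in auto)
    have "c1 h \<noteq> 0" if "h \<in> edges G" "h \<noteq> gv" for h
    proof
      assume "c1 h = 0"
      then have "h \<in> zeros c1" using that unfolding zeros_def by simp
      then show False using g(4) gg that by simp
    qed
    then have "zeros d4 = {}"
      using k_range unfolding zeros_def defs by auto
    moreover have "d4 e = k" using edges_distinct unfolding defs by auto
    moreover have "ends G h \<subseteq> ball 3 e" if h: "h \<in> edges G" "d4 h \<noteq> c h" for h
    proof (cases "h \<in> {e, gu, gv} \<or> z \<in> ends G h")
      case True
      then show ?thesis using ends_in_ball ballz[OF h(1)] by blast
    next
      case False
      then have "h \<noteq> f" "z \<notin> ends G h" using f0(2) by auto
      then have "d4 h = c h" using False away[of h] unfolding defs c'_def by simp
      then show ?thesis using h by simp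
    qed
    ultimately have "prepared c e" using 4 unfolding prepared_def by blast
    then show ?thesis using prepared_success R(1) by blast
  next
    fix g c2 assume g: "g \<in> edges G" "ends G g = {z, t}" "minimal c2" "c2 g = 1" "ones c2 = insert g (ones c')"
      and away: "\<And>h. z \<notin> ends G h \<Longrightarrow> c2 h = c' h" and keep: "\<And>h. h \<in> {gv} \<Longrightarrow> c2 h = c' h"
      and fr: "\<And>a. free c' z a \<Longrightarrow> 2 \<le> a \<Longrightarrow> free c2 z a"
    have c2k: "c2 gv = k" "c2 gu = k"
      using keep[of gv] away[of gu] gu dist fne R(5,6) unfolding c'_def by auto
    have close: "ends G h \<subseteq> ball 3 e" if "h \<in> edges G" "c2 h \<noteq> c h" for h
    proof (cases "z \<in> ends G h")
      case False
      then have "h \<noteq> f" using f0(2) by auto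
      then show ?thesis using that away[OF False] unfolding c'_def by simp
    qed (use ballz[OF that(1)] in auto)
    have trans: "success c e" if "success c2 e"
      using success_trans[OF that] close ball_mono[of 3 5 e] by auto
    note G2 = minimalD[OF g(3)]
    have c2e: "c2 e = 1" using G2 eM by auto
    show ?thesis
    proof (cases "t = w")
      case True
      \<comment> \<open>Now \<open>u\<close>, \<open>v\<close>, \<open>z\<close>, \<open>w\<close>
        lie on a 4-cycle alternating between \<open>1\<close> and \<open>k\<close>; the two colours
        are exchanged on it.\<close>
      have gne: "g \<noteq> e" "g \<noteq> gu" "g \<noteq> gv"
        using g(2) True ends_e gu gv dist by (auto simp: doubleton_eq_iff)
      note nn = gne gne[symmetric] edges_distinct edges_distinct[symmetric]
      define d1 where "d1 = c2(e := 0, gu := 0, gv := 0, g := 0)"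
      define d2 where "d2 = d1(e := k)"
      define d3 where "d3 = d2(g := k)"
      define d4 where "d4 = d3(gu := 1)"
      define d5 where "d5 = d4(gv := 1)"
      note defs = d1_def d2_def d3_def d4_def d5_def
      have gw: "ends G g = {z, w}" using g True by simp
      have 1: "partial_colouring d1" unfolding d1_def by (intro partial_colouring_uncolour G2)
      have uk: "free d1 u k" and wk: "free d2 w k"
        by (rule free_recoloured[OF G2(1) gu(1) _ c2k(2)];
            use gu ends_e dist k_range nn in \<open>auto simp: defs split: if_splits\<close>)+
      have vk: "free d1 v k" and zk: "free d2 z k"
        by (rule free_recoloured[OF G2(1) gv(1) _ c2k(1)];
            use gv ends_e dist k_range nn in \<open>auto simp: defs split: if_splits\<close>)+
      have 2: "partial_colouring d2" unfolding d2_def by (rule partial_colouring_colour[OF 1 ends_e uk vk k_range(2)])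
      have 3: "partial_colouring d3" unfolding d3_def by (rule partial_colouring_colour[OF 2 gw zk wk k_range(2)])
      have u1: "free d3 u 1" and v1: "free d4 v 1"
        by (rule free_recoloured[OF G2(1) eE _ c2e];
            use ends_e gu dist k_range nn in \<open>auto simp: defs split: if_splits\<close>)+
      have w1: "free d3 w 1" and z1: "free d4 z 1"
        by (rule free_recoloured[OF G2(1) g(1) _ g(4)];
            use gw gu dist k_range nn in \<open>auto simp: defs split: if_splits\<close>)+
      have 4: "partial_colouring d4" unfolding d4_def by (rule partial_colouring_colour[OF 3 gu(2) u1 w1 k_range(4)])
      have 5: "partial_colouring d5" unfolding d5_def by (rule partial_colouring_colour[OF 4 gv(2) v1 z1 k_range(4)])
      have "zeros d5 = {}" using G2(2) k_range unfolding zeros_def defs by auto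
      moreover have "d5 e = k" using nn unfolding defs by auto
      moreover have "ends G h \<subseteq> ball 3 e" if h: "h \<in> edges G" "d5 h \<noteq> c2 h" for h
        using h ends_in_ball ballz[OF g(1)] g(2) unfolding defs by (auto split: if_splits)
      ultimately have "prepared c2 e" using 5 unfolding prepared_def by blast
      then show ?thesis using prepared_success[OF g(3)] trans by blast
    next
      case tw: False
      have wg: "w \<notin> ends G g" using g(2) tw dist by auto
      have "free c2 w 1"
        by (rule free_weaken[OF R(7)]) (use g(5) o' wg in \<open>auto simp: ones_def set_eq_iff\<close>)
      then have rd2: "ready c2" using g(3) c2k unfolding ready_def by simp
      have "free c' z a" unfolding c'_def using a2 by (intro free_upd) auto
      then have za: "free c2 z a" using fr a2 by auto
      then have a': "a \<in> miss c2 z" using a unfolding miss_def by auto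
      have gno: "g \<notin> ones c" using ft g(1,2) unfolding ones_def free_def by auto
      have cls: "c h = a \<longleftrightarrow> c2 h = a" if "h \<in> edges G" for h
      proof (cases "z \<in> ends G h")
        case True
        then show ?thesis using za a2(2) that unfolding free_def by auto
      next
        case False
        then have "h \<noteq> f" using f0(2) by auto
        then have "c2 h = c h" using away[OF False] unfolding c'_def by simp
        then show ?thesis by simp
      qed
      have fq2: "free c2 q 1"
        unfolding free_def
      proof (intro ballI impI notI)
        fix h assume h: "h \<in> edges G" "q \<in> ends G h" "c2 h = 1"
        then have "h \<in> insert g (ones c - {f})" using g(5) o' unfolding ones_def by auto
        moreover have "h \<noteq> g" using h(2) g(2) zq t(3) by auto
        ultimately have "c h = 1" "h \<noteq> f" by (auto simp: ones_def)
        then show False using uq[of h f q] h f0 f by auto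
      qed
      have "ones c - {f} = ones c2 - {g}" using g(5) o' gno by auto
      then have tw: "twin a c f c2 g"
        using rd rd2 a a' cls fo g f qw fq2 tw ft unfolding twin_def by (auto simp: ones_def)
      have pc: ?thesis if "prepared c e" using prepared_success[OF R(1) that] .
      have pc2: ?thesis if "prepared c2 e" using prepared_success[OF g(3) that] trans by blast
      have f1: "success c e \<or> (\<exists>S. chain_to_w c a S \<or> chain_to c a S u \<or> chain_to c a S v)"
        by (rule chain[OF rd a f0(1) f f0(3)])
      have f2: "success c2 e \<or> (\<exists>S. chain_to_w c2 a S \<or> chain_to c2 a S u \<or> chain_to c2 a S v)"
        by (rule chain[OF rd2 a' g(1,2,4)])
      \<comment> \<open>A chain to \<open>v\<close> on either side is settled by
        \<open>twin_V\<close>; otherwise each chain ends in \<open>w\<close> or reaches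
        \<open>u\<close>, and all four combinations are covered.\<close>
      show ?thesis
        using f1 f2 trans pc pc2 twin_V[OF tw] twin_V[OF twin_sym[OF tw]] twin_WU[OF tw]
          twin_WU[OF twin_sym[OF tw]] twin_WW[OF tw] twin_UU[OF tw] by blast
    qed
  qed
qed

end

section \<open>Treating all edges of \<open>M\<close>\<close>

context precoloured
begin

text \<open>The edge of colour \<open>pre e\<close> at \<open>u\<close> leads to some
  \<open>w\<close>, which is freed of colour \<open>1\<close> by a local shift. If \<open>v\<close>
  then misses \<open>pre e\<close>, exchanging the colours of \<open>e\<close> and \<open>gu\<close>
  is enough; otherwise the edges of colour \<open>pre e\<close> at both ends form a
  \<open>configuration\<close>.\<close>

lemma minimal_success_aux:
  assumes c: "minimal c" and e: "e \<in> M" "ends G e = {u, v}" and k: "pre e \<noteq> 1" and nf: "\<not> free c u (pre e)"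
  shows "success c e"
proof -
  let ?k = "pre e"
  note C = minimalD[OF c]
  have eE: "e \<in> edges G" using e M_edges by auto
  have ce: "c e = 1" using C e by auto
  have k2: "2 \<le> ?k" "?k \<le> \<Delta> + \<mu>" using pre_range[OF e(1)] k by auto
  have uv: "u \<noteq> v" using ends_neq[OF eE e(2)] .
  obtain gu where gu0: "gu \<in> edges G" "u \<in> ends G gu" "c gu = ?k" using nf by (rule not_free_obtain)
  obtain w where gu: "ends G gu = {u, w}" "u \<noteq> w" using ends_cases[OF gu0(1,2)] by metis
  have egu: "e \<noteq> gu" using ce gu0(3) k by auto
  have ub: "u \<in> ball 0 e" "v \<in> ball 0 e" using e(2) by auto
  have eb: "ends G e \<subseteq> ball 3 e" using ball_edge[OF eE _ ub(1), of 3] e(2) by auto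
  have gub: "ends G gu \<subseteq> ball 3 e" using ball_edge[OF gu0(1,2) ub(1), of 3] by auto
  \<comment> \<open>The updates \<open>c1(gu := 0)\<close> and \<open>c1(e := 0)\<close> let the
    same exchange serve when \<open>gu\<close> is parallel to \<open>e\<close>.\<close>
  have one_sided: "prepared c1 e"
    if c1: "minimal c1" "c1 gu = ?k" and vk: "free (c1(gu := 0)) v ?k" and w1: "free (c1(e := 0)) w 1" for c1
  proof -
    note C1 = minimalD[OF c1(1)]
    have c1e: "c1 e = 1" using C1 e by auto
    define d1 where "d1 = c1(e := 0, gu := 0)"
    define d2 where "d2 = d1(e := ?k)"
    define d3 where "d3 = d2(gu := 1)"
    note defs = d1_def d2_def d3_def
    have 1: "partial_colouring d1" unfolding d1_def by (intro partial_colouring_uncolour C1)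
    have 2: "partial_colouring d2" unfolding d2_def
    proof (rule partial_colouring_colour[OF 1 e(2)])
      show "free d1 u ?k"
        by (rule free_recoloured[OF C1(1) gu0(1,2) c1(2)])
          (use k2 egu in \<open>auto simp: d1_def split: if_splits\<close>)
      show "free d1 v ?k"
        by (rule free_weaken[OF vk]) (use k2 in \<open>auto simp: d1_def split: if_splits\<close>)
    qed (use k2 in auto)
    have 3: "partial_colouring d3" unfolding d3_def
    proof (rule partial_colouring_colour[OF 2 gu(1)])
      show "free d2 u 1"
        by (rule free_recoloured[OF C1(1) eE _ c1e])
          (use e(2) k egu in \<open>auto simp: defs split: if_splits\<close>)
      show "free d2 w 1"
        by (rule free_weaken[OF w1]) (use k egu in \<open>auto simp: defs split: if_splits\<close>)
    qed (use k2 in auto)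
    have "zeros d3 = {}" using C1(5) k2 unfolding zeros_def defs by auto
    moreover have "d3 e = ?k" using egu unfolding defs by auto
    moreover have "ends G h \<subseteq> ball 3 e" if "h \<in> edges G" "d3 h \<noteq> c1 h" for h
      using that eb gub unfolding defs by (cases "h \<in> {e, gu}") auto
    ultimately show ?thesis using 3 unfolding prepared_def by blast
  qed
  show ?thesis
  proof (cases "w = v")
    case True
    have "free (c(gu := 0)) v ?k" using free_uncolour[OF C(1) gu0(1), of v] gu True gu0(3) k2 by auto
    moreover have "free (c(e := 0)) w 1" using free_uncolour[OF C(1) eE, of w] e True ce by auto
    ultimately have "prepared c e" using one_sided[OF c gu0(3)] by blast
    then show ?thesis using prepared_success[OF c] by blast
  next
    case wv: False
    have wb: "w \<in> ball 1 e" using ball_step[OF gu0(1) gu(1) ub(1) zero_less_one] .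
    obtain c1 where c1: "minimal c1" "c1 gu = ?k" "free c1 w 1"
      "\<And>h. h \<in> edges G \<Longrightarrow> c1 h \<noteq> c h \<Longrightarrow> ends G h \<subseteq> ball 5 e"
    proof (cases "free c w 1")
      case True
      then show ?thesis using that[of c] c gu0 by auto
    next
      case False
      obtain f where f0: "f \<in> edges G" "w \<in> ends G f" "c f = 1" using False by (rule not_free_obtain)
      obtain w' where f: "ends G f = {w, w'}" "w \<noteq> w'" using ends_cases[OF f0(1,2)] by metis
      have fe: "f \<noteq> e" using f0(2) e(2) gu(2) wv by auto
      have fM: "f \<notin> M" using M_in_ball[OF e(1) _ f0(2) wb] fe by auto
      have w'u: "w' \<noteq> u"
      proof
        assume "w' = u"
        then have "f = e" using partial_colouring_unique[OF C(1) f0(1) eE, of u] f e f0 ce by auto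
        then show False using fe by simp
      qed
      define c' where "c' = c(f := 0)"
      have p': "partial_colouring c'" unfolding c'_def using C(1) by (rule partial_colouring_uncolour)
      have z': "zeros c' = {f}" unfolding c'_def using C(2) f0 unfolding zeros_def by auto
      have o': "ones c' = ones c - {f}" unfolding c'_def ones_def by auto
      have M': "M \<subseteq> ones c'" unfolding o' using C(3) fM by auto
      have "f \<in> ones c" using f0 unfolding ones_def by auto
      then have n': "Suc (card (ones c')) = card (ones c)"
        unfolding o' using finite_ones by (intro card_Suc_Diff1)
      have irr: "irreducible c'" using minimal_hole_irreducible[OF c z' M'] n' by simp
      have "c' f = 0" unfolding c'_def by simp
      \<comment> \<open>Centring the fan at the far end \<open>w'\<close> and avoiding
        \<open>w\<close> moves the \<open>1\<close>-edge off \<open>w\<close>.\<close>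
      then obtain y where y: "(fan_step c' w')\<^sup>*\<^sup>* w y" "free c' y 1" "y \<noteq> w"
        by (rule fan_free_avoiding[OF p' irr f0(1) _ f(1), where s = w])
      have fw': "free c' w' 1" unfolding c'_def using free_uncolour[OF C(1) f0(1), of w'] f f0(3) by auto
      have fw: "free c' w 1" unfolding c'_def using free_uncolour[OF C(1) f0(1,2)] f0(3) by auto
      show ?thesis
      proof (rule hole_fill[OF c p' z' M' n' f(1) fw' y(1,2), where H = "{}"])
        fix g c1 assume g: "g \<in> edges G" "ends G g = {w', y}" "minimal c1" "ones c1 = insert g (ones c')"
          and away: "\<And>h. w' \<notin> ends G h \<Longrightarrow> c1 h = c' h"
        have "c1 gu = ?k"
        proof -
          have "w' \<notin> ends G gu" using gu w'u f(2) by auto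
          moreover have "gu \<noteq> f" using gu0(3) f0(3) k by auto
          ultimately show ?thesis using away gu0(3) unfolding c'_def by simp
        qed
        moreover have "free c1 w 1"
        proof (rule free_weaken[OF fw])
          fix h assume h: "h \<in> edges G" "w \<in> ends G h" "c1 h = 1"
          then have "h \<in> insert g (ones c')" unfolding g(4)[symmetric] by (simp add: ones_def)
          moreover have "h \<noteq> g" using h(2) g(2) y(3) f(2) by auto
          ultimately show "c' h = 1" by (simp add: ones_def)
        qed
        moreover have "ends G h \<subseteq> ball 5 e" if h: "h \<in> edges G" "c1 h \<noteq> c h" for h
        proof -
          have "w' \<in> ball 2 e" using ball_step[OF f0(1) f(1) wb, of 2] by simp
          moreover have "w' \<in> ends G h"
          proof (rule ccontr)
            assume "w' \<notin> ends G h"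
            moreover from this have "h \<noteq> f" using f(1) by auto
            ultimately show False using away h(2) unfolding c'_def by simp
          qed
          ultimately show ?thesis using ball_edge[OF h(1), of w' 2 e 5] by simp
        qed
        ultimately show ?thesis using that[of c1] g(3) by blast
      qed simp
    qed
    note C1 = minimalD[OF c1(1)]
    have "success c1 e"
    proof (cases "free c1 v ?k")
      case True
      have "prepared c1 e"
        using one_sided[OF c1(1,2) free_upd[OF True] free_upd[OF c1(3)]] k2 by auto
      then show ?thesis using prepared_success[OF c1(1)] by blast
    next
      case False
      obtain gv where gv0: "gv \<in> edges G" "v \<in> ends G gv" "c1 gv = ?k" using False by (rule not_free_obtain)
      obtain z where gv: "ends G gv = {v, z}" "v \<noteq> z" using ends_cases[OF gv0(1,2)] by metis
      have "gu \<noteq> gv"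
        using gu gv wv uv by (auto simp: doubleton_eq_iff)
      \<comment> \<open>Two edges of colour \<open>pre e\<close> share no endpoint, which yields
        four distinct vertices.\<close>
      then have "ends G gu \<inter> ends G gv = {}"
        using partial_colouring_unique[OF C1(1) gu0(1) gv0(1)] c1(2) gv0(3) k2 by auto
      then have dist: "distinct [u, v, w, z]" using gu gv uv wv by auto
      interpret configuration G \<Delta> \<mu> M pre e gu gv u v w z
        by unfold_locales (use e gu0 gu gv0 gv dist k in auto)
      have "ready c1" unfolding ready_def using c1 gv0 by auto
      then show ?thesis by (rule ready_success)
    qed
    then show ?thesis using success_trans c1(4) by blast
  qed
qed

lemma minimal_success:
  assumes c: "minimal c" and e: "e \<in> M"
  shows "success c e"
proof -
  note C = minimalD[OF c]
  have eE: "e \<in> edges G" using e M_edges by auto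
  have ce: "c e = 1" using C e by auto
  obtain u v where uv: "ends G e = {u, v}" using card_ends[OF eE] by (auto simp: card_2_iff)
  then have vu: "ends G e = {v, u}" by auto
  consider "pre e = 1" | "pre e \<noteq> 1" "\<not> free c u (pre e)" | "pre e \<noteq> 1" "\<not> free c v (pre e)"
    | "pre e \<noteq> 1" "free c u (pre e)" "free c v (pre e)" by blast
  then show ?thesis
  proof cases
    case 1
    then have "prepared c e" unfolding prepared_def using C ce by (intro exI[of _ c]) auto
    then show ?thesis using prepared_success[OF c] by blast
  next
    case 2
    then show ?thesis using minimal_success_aux[OF c e uv] by blast
  next
    case 3
    then show ?thesis using minimal_success_aux[OF c e vu] by blast
  next
    case 4
    have k: "1 \<le> pre e" "pre e \<le> \<Delta> + \<mu>" using pre_range[OF e] by auto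
    have "partial_colouring (c(e := pre e))" using partial_colouring_colour[OF C(1) uv 4(2,3) k(2)] .
    moreover have "zeros (c(e := pre e)) = {}" using C(5) k unfolding zeros_def by auto
    moreover have "ends G e \<subseteq> ball 3 e" using ball_mono[of 0 3 e] by simp
    ultimately have "prepared c e" unfolding prepared_def by (intro exI[of _ "c(e := pre e)"]) auto
    then show ?thesis using prepared_success[OF c] by blast
  qed
qed

text \<open>Since \<open>3 + 5 < 9\<close>, the change for \<open>f\<close> leaves every edge that
  touches \<open>ball 3 e\<close> alone. So the old witness can be kept inside
  \<open>ball 3 e\<close> and combined with \<open>c'\<close> elsewhere; around any vertex the
  result agrees with one of the two.\<close>

lemma prepared_persists:
  assumes p: "prepared c e" and e: "e \<in> M" "f \<in> M" "e \<noteq> f" and c: "partial_colouring c'" "zeros c' = {}"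
    and ch: "\<And>g. g \<in> edges G \<Longrightarrow> c' g \<noteq> c g \<Longrightarrow> ends G g \<subseteq> ball 5 f"
  shows "prepared c' e"
proof -
  obtain d where d: "partial_colouring d" "zeros d = {}" "d e = pre e"
    "\<And>g. g \<in> edges G \<Longrightarrow> d g \<noteq> c g \<Longrightarrow> ends G g \<subseteq> ball 3 e"
    using p unfolding prepared_def by blast
  have same: "c' g = c g" if "g \<in> edges G" "y \<in> ends G g" "y \<in> ball 3 e" for g y
    using ch[of g] ball_far[OF e that(3), of 5] that by fastforce
  let ?d = "\<lambda>g. if ends G g \<subseteq> ball 3 e then d g else c' g"
  have near: "?d g = d g" if "g \<in> edges G" "y \<in> ends G g" "y \<in> ball 3 e" for g y
    using same[OF that] d(4)[OF that(1)] by auto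
  have "partial_colouring ?d"
    unfolding partial_colouring_def
  proof (intro conjI ballI impI)
    fix g assume "g \<in> edges G"
    then show "?d g \<le> \<Delta> + \<mu>" using d(1) c(1) partial_colouring_le by auto
  next
    fix g h assume gh: "g \<in> edges G" "h \<in> edges G" "g \<noteq> h" "ends G g \<inter> ends G h \<noteq> {}" "?d g = ?d h"
    then obtain y where y: "y \<in> ends G g" "y \<in> ends G h" by blast
    show "?d g = 0"
    proof (cases "y \<in> ball 3 e")
      case True
      then have "d g = d h" using near[OF gh(1) y(1)] near[OF gh(2) y(2)] gh(5) by simp
      then have "d g = 0" using partial_colouring_unique[OF d(1) gh(1,2) y] gh(3) by blast
      then show ?thesis using near[OF gh(1) y(1) True] by simp
    next
      case False
      then have nb: "\<not> ends G g \<subseteq> ball 3 e" "\<not> ends G h \<subseteq> ball 3 e" using y by auto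
      then have "c' g = c' h" using gh(5) by simp
      then have "c' g = 0" using partial_colouring_unique[OF c(1) gh(1,2) y] gh(3) by blast
      then show ?thesis using nb by simp
    qed
  qed
  moreover have "zeros ?d = {}" using d(2) c(2) unfolding zeros_def by auto
  moreover have "?d e = pre e" using d(3) ball_mono[of 0 3 e] by simp
  ultimately show ?thesis unfolding prepared_def by (intro exI[of _ ?d]) auto
qed

text \<open>\<open>minimal_success\<close> is applied to one edge of \<open>M\<close> after another;
  the edges treated earlier stay prepared.\<close>

lemma all_prepared: "\<exists>c. minimal c \<and> (\<forall>e \<in> M. prepared c e)"
proof -
  have "finite M" using M_edges finite_edges finite_subset by blast
  have "\<exists>c. minimal c \<and> (\<forall>e \<in> A. prepared c e)" if "A \<subseteq> M" "finite A" for A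
    using that(2,1)
  proof (induction A rule: finite_induct)
    case empty
    then show ?case using exists_minimal by auto
  next
    case (insert f A)
    then obtain c where c: "minimal c" "\<And>e. e \<in> A \<Longrightarrow> prepared c e" by auto
    have f: "f \<in> M" using insert by auto
    obtain c' where c': "minimal c'" "prepared c' f"
      "\<And>g. g \<in> edges G \<Longrightarrow> c' g \<noteq> c g \<Longrightarrow> ends G g \<subseteq> ball 5 f"
      using minimal_success[OF c(1) f] unfolding success_def by blast
    have "prepared c' e" if "e \<in> A" for e
      using prepared_persists[OF c(2)[OF that] _ f _ minimalD(1,2)[OF c'(1)] c'(3)] that insert by auto
    then show ?case using c' by auto
  qed
  then show ?thesis using \<open>finite M\<close> by blast
qed

text \<open>In \<open>c\<close> all of \<open>M\<close> still has colour \<open>1\<close>. The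
  witnesses of \<open>prepared\<close> are now inserted simultaneously, which is possible because
  they act in disjoint balls of radius \<open>3\<close>.\<close>

theorem extend_precolouring:
  "\<exists>c. proper_edge_colouring G c \<and> (\<forall>g \<in> edges G. c g \<in> {1..\<Delta> + \<mu>}) \<and> (\<forall>e \<in> M. c e = pre e)"
proof -
  obtain c where c: "minimal c" "\<And>e. e \<in> M \<Longrightarrow> prepared c e" using all_prepared by blast
  define fin where "fin e d \<longleftrightarrow> partial_colouring d \<and> zeros d = {} \<and> d e = pre e \<and>
    (\<forall>g \<in> edges G. d g \<noteq> c g \<longrightarrow> ends G g \<subseteq> ball 3 e)" for e d
  define D where "D e = (SOME d. fin e d)" for e
  have D: "fin e (D e)" if "e \<in> M" for e
    using c(2)[OF that] unfolding prepared_def D_def fin_def by (rule someI_ex)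
  define near where "near g e \<longleftrightarrow> e \<in> M \<and> ends G g \<subseteq> ball 3 e" for g e
  define h where "h g = (if \<exists>e. near g e then D (SOME e. near g e) g else c g)" for g
  have uniq: "e = f" if "e \<in> M" "f \<in> M" "y \<in> ball 3 e" "y \<in> ball 3 f" for e f y
    using ball_far[OF that(1,2) _ that(3,4)] by fastforce
  have ne: "\<exists>y. y \<in> ends G g" if "g \<in> edges G" for g using card_ends[OF that] by (metis card.empty equals0I zero_neq_numeral)
  have hD: "h g = D e g" if "e \<in> M" "g \<in> edges G" "y \<in> ends G g" "y \<in> ball 3 e" for e g y
  proof (cases "\<exists>e'. near g e'")
    case True
    define e' where "e' = (SOME e'. near g e')"
    have "near g e'" unfolding e'_def by (rule someI_ex[OF True])
    then have "e' = e" using uniq[of e' e y] that unfolding near_def by auto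
    then show ?thesis using True unfolding h_def e'_def by simp
  next
    case False
    then have "D e g = c g" using D[OF that(1)] that unfolding fin_def near_def by auto
    then show ?thesis unfolding h_def using False by (metis (full_types))
  qed
  have hc: "h g = c g" if "g \<in> edges G" "y \<in> ends G g" "\<And>e. e \<in> M \<Longrightarrow> y \<notin> ball 3 e" for g y
    using that unfolding h_def near_def by auto
  \<comment> \<open>Properness and range are local: around each vertex \<open>h\<close> agrees with
    a single complete colouring, some \<open>D e\<close> or \<open>c\<close>.\<close>
  have loc: "\<exists>d. partial_colouring d \<and> zeros d = {} \<and> (\<forall>g \<in> edges G. y \<in> ends G g \<longrightarrow> h g = d g)" for y
  proof (cases "\<exists>e \<in> M. y \<in> ball 3 e")
    case True
    then obtain e where "e \<in> M" "y \<in> ball 3 e" by blast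
    then show ?thesis using hD D unfolding fin_def by blast
  next
    case False
    then show ?thesis using hc minimalD(1,2)[OF c(1)] by blast
  qed
  have "proper_edge_colouring G h"
    unfolding proper_edge_colouring_def
  proof (intro ballI impI notI)
    fix g g' assume g: "g \<in> edges G" "g' \<in> edges G" "g \<noteq> g'" "ends G g \<inter> ends G g' \<noteq> {}" "h g = h g'"
    then obtain y where y: "y \<in> ends G g" "y \<in> ends G g'" by blast
    obtain d where d: "partial_colouring d" "zeros d = {}" "\<forall>g \<in> edges G. y \<in> ends G g \<longrightarrow> h g = d g" using loc by blast
    then have "d g = d g'" "d g \<noteq> 0" using g y unfolding zeros_def by auto
    then show False using partial_colouring_unique[OF d(1) g(1,2) y] g(3) by blast
  qed
  moreover have "h g \<in> {1..\<Delta> + \<mu>}" if g: "g \<in> edges G" for g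
  proof -
    obtain y where y: "y \<in> ends G g" using ne[OF g] by blast
    obtain d where d: "partial_colouring d" "zeros d = {}" "\<forall>g \<in> edges G. y \<in> ends G g \<longrightarrow> h g = d g" using loc by blast
    then have "h g = d g" "d g \<noteq> 0" using g y unfolding zeros_def by auto
    then show ?thesis using partial_colouring_le[OF d(1) g] by auto
  qed
  moreover have "h e = pre e" if e: "e \<in> M" for e
  proof -
    have eE: "e \<in> edges G" using e M_edges by auto
    obtain y where y: "y \<in> ends G e" using ne[OF eE] by blast
    then have "y \<in> ball 3 e" using ball_mono[of 0 3 e] by auto
    then show ?thesis using hD[OF e eE y] D[OF e] unfolding fin_def by simp
  qed
  ultimately show ?thesis by blast
qed

end

theorem theorem3:
  fixes G :: "('v, 'e) mgraph" and M :: "'e set" and \<mu> \<Delta> :: nat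
    and K :: "nat set" and pre :: "'e \<Rightarrow> nat"
  assumes "multigraph G"
    and "max_multiplicity G = \<mu>"
    and "max_degree G = \<Delta>"
    and "M \<subseteq> edges G"
    and "\<And>e f. \<lbrakk>e \<in> M; f \<in> M; e \<noteq> f\<rbrakk> \<Longrightarrow> edge_distance G e f \<ge> 9"
    and "K = {1..\<Delta> + \<mu>}"
    and "\<And>e. e \<in> M \<Longrightarrow> pre e \<in> K"
  shows "\<exists>c :: 'e \<Rightarrow> nat. proper_edge_colouring G c \<and> (\<forall>e \<in> edges G. c e \<in> K) \<and>
           (\<forall>e \<in> M. c e = pre e)"
proof -
  interpret multigraph G by fact
  interpret precoloured G \<Delta> \<mu> M pre
  proof unfold_locales
    fix y assume "y \<in> verts G"
    then have "degree G y \<le> max_degree G"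
      unfolding max_degree_def using finite_verts by (intro Max_ge) auto
    then show "degree G y \<le> \<Delta>" using assms(3) by simp
  next
    fix x y assume "x \<in> verts G" "y \<in> verts G"
    then have "multiplicity G x y \<le> max_multiplicity G"
      unfolding max_multiplicity_def using finite_verts by (intro Max_ge) force+
    then show "multiplicity G x y \<le> \<mu>" using assms(2) by simp
  qed (use assms(4-7) in auto)
  show ?thesis using extend_precolouring assms(6) by simp
qed

end
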